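(* Let $k\ge1$ be an integer and let $\Phi$ be a positive real-valued function on $\{0,1,2,\dots\}$ such that $\Phi(n)\to\infty$ as $n\to\infty$. Let $$\mathcal G_k(\Phi)=\Big\{x\in I:\ \sum_{i=1}^k\deg A_{n+i}(x)\ge\Phi(n)\ \text{for all } n\ge0\Big\}.$$ Then $$\dim_{\mathcal H}\mathcal G_k(\Phi)=\frac1{a+1},$$ where $1\le a\le\infty$ is defined by $\log a=\limsup_{n\to\infty}\frac{\log\Phi(n)}{n}$ (and $\frac1{a+1}$ is read as $0$ when $a=\infty$).
   Context: $\mathbb{F}_q$ is a finite field with $q$ elements and $\mathbb{F}_q((z^{-1}))$ is the field of formal Laurent series $x=\sum_{n=v}^\infty c_nz^{-n}$ ($v\in\mathbb Z$, $c_n\in\mathbb{F}_q$), with the non-Archimedean absolute value $|0|_\infty=0$ and $|x|_\infty=q^{-v}$ if $c_v\neq0$ is the first non-zero coefficient. The integer part of $x$ is the polynomial $[x]=\sum_{n=v}^0c_nz^{-n}\in\mathbb{F}_q[z]$. $I=\{x:|x|_\infty<1\}$. The Gauss map $T:I\to I$ is $T(x)=\frac1x-[\frac1x]$ for $x\ne0$, $T(0)=0$. The partial quotients of $x\in I$ are $A_i(x)=[1/T^{i-1}(x)]$, $i\ge1$, defined as long as $T^{i-1}(x)\neq0$; they are polynomials in $\mathbb{F}_q[z]$ of strictly positive degree. An inequality involving $\deg A_{n+1}(x),\dots,\deg A_{n+k}(x)$ is understood to require that these partial quotients are defined. $\dim_{\mathcal H}$ is Hausdorff dimension with respect to the metric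 $\rho(x,y)=|x-y|_\infty$. *)

theory Defs
  imports
    "HOL-Analysis.Analysis"
    "HOL-Computational_Algebra.Formal_Laurent_Series"
begin

text \<open>
  The field $F_q((z^{-1}))$ is the type of formal Laurent series over a finite field of
  cardinality $q$, where the variable \<^const>\<open>fls_X\<close> stands for $z^{-1}$; thus \<^const>\<open>fls_X_inv\<close>
  is $z$, and the coefficient of $z^{-n}$ in \<open>x\<close> is \<open>fls_nth x n\<close>.
\<close>

definition abs_infty :: "'a :: {field, finite} fls \<Rightarrow> real" where
  "abs_infty x = (if x = 0 then 0 else real CARD('a) powi (- fls_subdegree x))"

text \<open>
  The library instance of \<^class>\<open>metric_space\<close> for \<^type>\<open>fls\<close> has base 2 instead of \<open>q\<close>, which
  changes Hausdorff dimensions by a constant factor, so the metric is given explicitly.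
\<close>
definition rho_infty :: "'a :: {field, finite} fls \<Rightarrow> 'a fls \<Rightarrow> real" where
  "rho_infty x y = abs_infty (x - y)"

definition unit_ideal :: "'a :: {field, finite} fls set" where
  "unit_ideal = {x. abs_infty x < 1}"

text \<open>
  The integer part, as a polynomial in $z$: its coefficient of $z^n$ is \<open>fls_nth x (- int n)\<close>.
  (\<^const>\<open>fls_prpart\<close> contributes only the degrees \<open>n \<ge> 1\<close>.)
\<close>
definition int_part :: "'a :: field fls \<Rightarrow> 'a poly" where
  "int_part x = fls_prpart x + [:fls_nth x 0:]"

text \<open>The inclusion of $F_q[z]$ into $F_q((z^{-1}))$, i.e. evaluation at $z$.\<close>
definition poly_in_z :: "'a :: field poly \<Rightarrow> 'a fls" where
  "poly_in_z p = poly (map_poly fls_const p) fls_X_inv"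

definition gauss_map :: "'a :: field fls \<Rightarrow> 'a fls" where
  "gauss_map x = (if x = 0 then 0 else 1 / x - poly_in_z (int_part (1 / x)))"

definition partial_quotient_defined :: "'a :: field fls \<Rightarrow> nat \<Rightarrow> bool" where
  "partial_quotient_defined x i \<longleftrightarrow> i \<ge> 1 \<and> (gauss_map ^^ (i - 1)) x \<noteq> 0"

text \<open>Meaningful only where \<^const>\<open>partial_quotient_defined\<close> holds.\<close>
definition partial_quotient :: "'a :: field fls \<Rightarrow> nat \<Rightarrow> 'a poly" where
  "partial_quotient x i = int_part (1 / (gauss_map ^^ (i - 1)) x)"

definition G_set :: "nat \<Rightarrow> (nat \<Rightarrow> real) \<Rightarrow> 'a :: {field, finite} fls set" where
  "G_set k \<Phi> = {x \<in> unit_ideal. \<forall>n.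
     (\<forall>i\<in>{1..k}. partial_quotient_defined x (n + i)) \<and>
     (\<Sum>i=1..k. real (degree (partial_quotient x (n + i)))) \<ge> \<Phi> n}"

text \<open>Hausdorff measure and dimension with respect to an explicitly given metric \<open>d\<close>.\<close>

definition diam_wrt :: "('b \<Rightarrow> 'b \<Rightarrow> real) \<Rightarrow> 'b set \<Rightarrow> ennreal" where
  "diam_wrt d U = (SUP x\<in>U. SUP y\<in>U. ennreal (d x y))"

definition hausdorff_premeasure ::
  "('b \<Rightarrow> 'b \<Rightarrow> real) \<Rightarrow> real \<Rightarrow> real \<Rightarrow> 'b set \<Rightarrow> ennreal" where
  "hausdorff_premeasure d s \<delta> E =
     (INF U\<in>{U :: nat \<Rightarrow> 'b set. E \<subseteq> (\<Union>i. U i) \<and> (\<forall>i. diam_wrt d (U i) \<le> ennreal \<delta>)}.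
        \<Sum>i. ennreal (enn2real (diam_wrt d (U i)) powr s))"

definition hausdorff_measure :: "('b \<Rightarrow> 'b \<Rightarrow> real) \<Rightarrow> real \<Rightarrow> 'b set \<Rightarrow> ennreal" where
  "hausdorff_measure d s E = (SUP \<delta>\<in>{0<..}. hausdorff_premeasure d s \<delta> E)"

text \<open>
  Only exponents \<open>s > 0\<close> are used, since \<open>0 powr 0 = 0\<close> would give the wrong
  zero-dimensional measure (it should be the counting measure); this does not affect the infimum. A set with no admissible
  exponent has dimension \<open>\<infinity>\<close>.
\<close>
definition hausdorff_dim :: "('b \<Rightarrow> 'b \<Rightarrow> real) \<Rightarrow> 'b set \<Rightarrow> ereal" where
  "hausdorff_dim d E = (INF s\<in>{s. s > 0 \<and> hausdorff_measure d s E = 0}. ereal s)"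

text \<open>The logarithm on $[1,\infty]$ with $\log\infty = \infty$; other arguments are irrelevant.\<close>
definition ln_ext :: "ereal \<Rightarrow> ereal" where
  "ln_ext a = (if a = \<infinity> then \<infinity> else ereal (ln (real_of_ereal a)))"

lemma ex1_ln_ext:
  assumes "0 \<le> L"
  shows "\<exists>!a. 1 \<le> a \<and> ln_ext a = L"
proof (cases L)
  case (real r)
  show ?thesis
  proof (rule ex1I[of _ "ereal (exp r)"])
    show "1 \<le> ereal (exp r) \<and> ln_ext (ereal (exp r)) = L"
      using assms real by (simp add: ln_ext_def)
  next
    fix a assume "1 \<le> a \<and> ln_ext a = L"
    then show "a = ereal (exp r)"
      using real by (cases a) (auto simp: ln_ext_def)
  qed
next
  case PInf
  show ?thesis
    by (rule ex1I[of _ \<infinity>]) (auto simp: PInf ln_ext_def split: if_splits)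
qed (use assms in auto)

end

theory Submission
  imports Defs "HOL-Probability.Infinite_Product_Measure"
begin

text \<open>
  Write $S_n$ for the sum of the degrees of the first $n$ partial quotients. If $x$ and $y$ share
  them, then $|x - y|_\infty = q^{-2S_n} |T^n x - T^n y|_\infty$.

  Upper bound. On $\mathcal G_k(\Phi)$ the quotient $S_n / n$ tends to infinity uniformly. If
  $1 < c < a$, then $S_{n+k} \ge \Phi(n) \ge b^n$ infinitely often for some $b > c$, so
  $S_{m+1} \ge c S_m$ for infinitely many $m$; for $c = 1$ this is trivial. The points with given
  first $m$ partial quotients and $S_{m+1} \ge c S_m$ form a set of diameter at most
  $q^{-(c+1)S_m}$, there are $(q-1) q^d$ polynomials of degree $d$, and $S_m \ge M m$ absorbs the
  remaining exponential factors, so these covers give dimension at most $1/(c+1)$.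

  Lower bound. For $b > a$ prescribe $\deg A_{n+1} = D_n$ of order $b^n$, large enough to force
  membership in $\mathcal G_k(\Phi)$, and choose the partial quotients independently and uniformly.
  A set whose points first disagree at index $n$, by polynomials of maximal degree $e$, has mass
  at most $q^{-S_{n+1}+e+1}$ and diameter at least $q^{-2S_{n+1}+e}$; the extreme case
  $e = D_n$ gives the local dimension $S_n / (2 S_n + D_n)$, which tends to $1/(b+1)$.
\<close>

subsection \<open>The absolute value\<close>

lemma card_field_ge_2: "2 \<le> CARD('a :: {field, finite})"
proof -
  have "card {0, 1 :: 'a} \<le> CARD('a)"
    by (rule card_mono) auto
  then show ?thesis by simp
qed

lemma card_field_gt_1: "1 < real CARD('a :: {field, finite})"
  using card_field_ge_2[where 'a = 'a] by linarith

lemma abs_infty_0 [simp]: "abs_infty 0 = 0"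
  by (simp add: abs_infty_def)

lemma abs_infty_pos_iff [simp]: "0 < abs_infty x \<longleftrightarrow> x \<noteq> 0"
  for x :: "'a :: {field, finite} fls"
  using card_field_gt_1[where 'a = 'a]
  by (simp add: abs_infty_def)

lemma abs_infty_nonneg [simp]: "0 \<le> abs_infty x"
  by (simp add: abs_infty_def)

lemma abs_infty_eq_0_iff [simp]: "abs_infty x = 0 \<longleftrightarrow> x = 0"
  using abs_infty_pos_iff[of x] by (auto simp del: abs_infty_pos_iff)

lemma abs_infty_eq_powr:
  fixes x :: "'a :: {field, finite} fls"
  assumes "x \<noteq> 0"
  shows "abs_infty x = real CARD('a) powr (- of_int (fls_subdegree x))"
  using assms powr_real_of_int'[of "real CARD('a)" "- fls_subdegree x"]
  by (simp add: abs_infty_def)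

lemma abs_infty_mult: "abs_infty (x * y) = abs_infty x * abs_infty y"
  for x y :: "'a :: {field, finite} fls"
  by (cases "x = 0 \<or> y = 0") (auto simp: abs_infty_eq_powr powr_add[symmetric])

lemma abs_infty_minus [simp]: "abs_infty (- x) = abs_infty x"
  by (simp add: abs_infty_def)

text \<open>Balls around 0 are coefficient conditions; this turns the convergence estimates below
  into identities between coefficients.\<close>

lemma abs_infty_le_iff_nth:
  fixes x :: "'a :: {field, finite} fls"
  shows "abs_infty x \<le> real CARD('a) powr (- of_int n) \<longleftrightarrow> (\<forall>j<n. fls_nth x j = 0)"
proof (cases "x = 0")
  case False
  have "abs_infty x \<le> real CARD('a) powr (- of_int n) \<longleftrightarrow> n \<le> fls_subdegree x"
    using False card_field_gt_1[where 'a = 'a] by (simp add: abs_infty_eq_powr)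
  also have "\<dots> \<longleftrightarrow> (\<forall>j<n. fls_nth x j = 0)"
    using False fls_subdegree_geI[of x n] nth_fls_subdegree_nonzero[of x] by force
  finally show ?thesis .
qed (use card_field_gt_1[where 'a = 'a] in simp)

lemma unit_ideal_iff_subdegree:
  "x \<in> unit_ideal \<longleftrightarrow> x = 0 \<or> 1 \<le> fls_subdegree x"
  for x :: "'a :: {field, finite} fls"
  using card_field_gt_1[where 'a = 'a]
    powr_less_cancel_iff[of "real CARD('a)" "- of_int (fls_subdegree x)" 0]
  by (cases "x = 0") (simp_all add: unit_ideal_def abs_infty_eq_powr, linarith)

lemma unit_ideal_iff_nth: "x \<in> unit_ideal \<longleftrightarrow> (\<forall>j\<le>0. fls_nth x j = 0)"
  for x :: "'a :: {field, finite} fls"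
proof -
  have "x \<in> unit_ideal \<longleftrightarrow> (\<forall>j<1. fls_nth x j = 0)"
  proof (cases "x = 0")
    case False
    then have "1 \<le> fls_subdegree x \<longleftrightarrow> (\<forall>j<1. fls_nth x j = 0)"
      using fls_subdegree_geI[of x 1] nth_fls_subdegree_nonzero[of x] by force
    then show ?thesis using False by (simp add: unit_ideal_iff_subdegree)
  qed (simp add: unit_ideal_iff_subdegree)
  moreover have "j < 1 \<longleftrightarrow> j \<le> 0" for j :: int
    by linarith
  ultimately show ?thesis by simp
qed

lemma zero_in_unit_ideal [simp]: "0 \<in> unit_ideal"
  by (simp add: unit_ideal_def)

lemma unit_ideal_diff: "x \<in> unit_ideal \<Longrightarrow> y \<in> unit_ideal \<Longrightarrow> x - y \<in> unit_ideal"
  by (simp add: unit_ideal_iff_nth)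

text \<open>The larger term has the smaller subdegree and supplies a leading coefficient that
  nothing can cancel.\<close>

lemma abs_infty_add_eq_left:
  fixes x y :: "'a :: {field, finite} fls"
  assumes "abs_infty y < abs_infty x"
  shows "abs_infty (x + y) = abs_infty x"
proof -
  have x: "x \<noteq> 0" using assms by (metis abs_infty_0 abs_infty_nonneg not_less)
  show ?thesis
  proof (cases "y = 0")
    case False
    have "fls_subdegree x < fls_subdegree y"
      using assms x False card_field_gt_1[where 'a = 'a] by (simp add: abs_infty_eq_powr)
    then have *: "fls_subdegree (x + y) = fls_subdegree x"
      by (rule fls_subdegree_add_eq1[OF x])
    have "x + y \<noteq> 0"
      using \<open>fls_subdegree x < fls_subdegree y\<close> by (metis add_eq_0_iff2 fls_uminus_subdegree less_irrefl)
    then show ?thesis using * x by (simp add: abs_infty_eq_powr)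
  qed simp
qed

text \<open>The leading coefficient of \<open>x - y\<close> sits at an index where \<open>x\<close>
  or \<open>y\<close> is nonzero. This is the ultrametric inequality in the form used for
  diameters.\<close>

lemma abs_infty_diff_le:
  fixes x y :: "'a :: {field, finite} fls"
  assumes "abs_infty x \<le> r" "abs_infty y \<le> r"
  shows "abs_infty (x - y) \<le> r"
proof (cases "x = y")
  case True
  then show ?thesis using assms(1) abs_infty_nonneg[of x] by (simp del: abs_infty_nonneg)
next
  case False
  then have "fls_nth (x - y) (fls_subdegree (x - y)) \<noteq> 0"
    using nth_fls_subdegree_nonzero[of "x - y"] by (metis right_minus_eq)
  then obtain z where z: "z = x \<or> z = y" "fls_nth z (fls_subdegree (x - y)) \<noteq> 0"
    by (cases "fls_nth x (fls_subdegree (x - y)) = 0") auto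
  then have "z \<noteq> 0" "fls_subdegree z \<le> fls_subdegree (x - y)"
    by (auto simp: fls_subdegree_leI)
  then have "abs_infty (x - y) \<le> abs_infty z"
    using False card_field_gt_1[where 'a = 'a] by (simp add: abs_infty_eq_powr)
  then show ?thesis using assms z(1) by auto
qed

subsection \<open>Continued fractions\<close>

lemma fls_nth_poly_in_z:
  "fls_nth (poly_in_z p) j = (if j \<le> 0 then coeff p (nat (- j)) else 0)"
  for p :: "'a :: {field, finite} poly"
proof -
  have "fls_nth (sum f A) j = (\<Sum>i\<in>A. fls_nth (f i) j)" for f :: "nat \<Rightarrow> 'a fls" and A
    by (induction A rule: infinite_finite_induct) auto
  then have "fls_nth (poly_in_z p) j
      = (\<Sum>i\<le>degree p. coeff p i * (if j = - int i then 1 else 0))"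
    by (simp add: poly_in_z_def poly_altdef degree_map_poly coeff_map_poly)
  also have "\<dots> = (\<Sum>i\<le>degree p. if i = nat (- j) \<and> j \<le> 0 then coeff p i else 0)"
    by (rule sum.cong) auto
  also have "\<dots> = (if j \<le> 0 then coeff p (nat (- j)) else 0)"
    by (auto simp: coeff_eq_0 intro: leI)
  finally show ?thesis .
qed

lemma poly_in_z_diff: "poly_in_z (p - r) = poly_in_z p - poly_in_z r"
  for p r :: "'a :: {field, finite} poly"
  by (rule fls_eqI) (simp add: fls_nth_poly_in_z)

lemma poly_in_z_eq_0_iff [simp]: "poly_in_z p = 0 \<longleftrightarrow> p = 0"
  for p :: "'a :: {field, finite} poly"
proof
  assume "poly_in_z p = 0"
  then have "coeff p n = 0" for n
    using fls_nth_poly_in_z[of p "- int n"] by simp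
  then show "p = 0" by (simp add: poly_eq_iff)
qed (simp add: poly_in_z_def)

lemma fls_subdegree_poly_in_z: "fls_subdegree (poly_in_z p) = - int (degree p)"
  for p :: "'a :: {field, finite} poly"
proof (cases "p = 0")
  case False
  then show ?thesis
    by (intro fls_subdegree_eqI) (auto simp: fls_nth_poly_in_z coeff_eq_0)
qed (simp add: poly_in_z_def)

lemma abs_infty_poly_in_z:
  fixes p :: "'a :: {field, finite} poly"
  assumes "p \<noteq> 0"
  shows "abs_infty (poly_in_z p) = real CARD('a) powr degree p"
  using assms by (simp add: abs_infty_eq_powr fls_subdegree_poly_in_z)

lemma coeff_int_part: "coeff (int_part x) n = fls_nth x (- int n)"
  by (cases n) (auto simp: int_part_def)

lemma diff_int_part_in_unit_ideal: "x - poly_in_z (int_part x) \<in> unit_ideal"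
  for x :: "'a :: {field, finite} fls"
  by (simp add: unit_ideal_iff_nth fls_nth_poly_in_z coeff_int_part)

text \<open>Polynomial and fractional part occupy disjoint ranges of coefficients, so the
  decomposition is unique; this later recovers prescribed partial quotients.\<close>

lemma int_part_poly_in_z_add:
  fixes p :: "'a :: {field, finite} poly"
  assumes "y \<in> unit_ideal"
  shows "int_part (poly_in_z p + y) = p"
  using assms by (simp add: poly_eq_iff coeff_int_part fls_nth_poly_in_z unit_ideal_iff_nth)

lemma abs_infty_poly_in_z_add:
  fixes p :: "'a :: {field, finite} poly"
  assumes "p \<noteq> 0" and "y \<in> unit_ideal"
  shows "abs_infty (poly_in_z p + y) = real CARD('a) powr degree p"
proof -
  have "1 \<le> real CARD('a) powr degree p"
    using card_field_gt_1[where 'a = 'a] by (simp add: ge_one_powr_ge_zero)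
  then have "abs_infty y < real CARD('a) powr degree p"
    using assms(2) by (simp add: unit_ideal_def)
  then show ?thesis
    using abs_infty_add_eq_left[of y "poly_in_z p"] assms(1) by (simp add: abs_infty_poly_in_z)
qed

section \<open>The Gauss map and the size of partial quotients\<close>

lemma gauss_map_in_unit_ideal: "gauss_map x \<in> unit_ideal"
  for x :: "'a :: {field, finite} fls"
  by (simp add: gauss_map_def diff_int_part_in_unit_ideal)

text \<open>The fractional part is smaller than 1, hence than \<open>x\<close>, so the integer part
  cannot vanish and carries the whole absolute value.\<close>

lemma degree_int_part:
  fixes x :: "'a :: {field, finite} fls"
  assumes "1 \<le> abs_infty x"
  shows "abs_infty x = real CARD('a) powr degree (int_part x)" "int_part x \<noteq> 0"
proof -
  let ?y = "x - poly_in_z (int_part x)"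
  have y: "?y \<in> unit_ideal" by (rule diff_int_part_in_unit_ideal)
  show nz: "int_part x \<noteq> 0"
    using assms y by (auto simp: unit_ideal_def poly_in_z_def)
  show "abs_infty x = real CARD('a) powr degree (int_part x)"
    using abs_infty_poly_in_z_add[OF nz y] by simp
qed

lemma abs_infty_inverse: "abs_infty (inverse x) = inverse (abs_infty x)"
  for x :: "'a :: {field, finite} fls"
  using card_field_gt_1[where 'a = 'a]
  by (cases "x = 0") (simp_all add: abs_infty_eq_powr powr_minus)

lemma abs_infty_div: "abs_infty (x / y) = abs_infty x / abs_infty y"
  for x y :: "'a :: {field, finite} fls"
  by (simp add: divide_inverse abs_infty_mult abs_infty_inverse)

lemma abs_infty_1 [simp]: "abs_infty (1 :: 'a :: {field, finite} fls) = 1"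
  using card_field_gt_1[where 'a = 'a] by (simp add: abs_infty_eq_powr)

text \<open>\<open>digit x i\<close> is $A_{i+1}(x)$.\<close>
abbreviation digit :: "'a :: field fls \<Rightarrow> nat \<Rightarrow> 'a poly" where
  "digit x i \<equiv> partial_quotient x (Suc i)"

lemma digit_funpow_gauss_map: "digit ((gauss_map ^^ m) x) i = digit x (i + m)"
  by (simp add: partial_quotient_def funpow_add)

lemma abs_infty_eq_powr_digit:
  fixes x :: "'a :: {field, finite} fls"
  assumes "x \<noteq> 0" "x \<in> unit_ideal"
  shows "abs_infty x = real CARD('a) powr (- degree (digit x 0))"
proof -
  have "1 \<le> abs_infty (1 / x)"
    using assms by (simp add: abs_infty_div unit_ideal_def)
  note d = degree_int_part[OF this]
  have "abs_infty x = inverse (abs_infty (1 / x))"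
    by (simp add: abs_infty_div)
  then show ?thesis
    unfolding d(1) by (simp add: partial_quotient_def powr_minus)
qed

text \<open>These are the elements of I outside F_q(z): a continued fraction terminates exactly for
  rational functions.\<close>

definition infinite_cf :: "'a :: {field, finite} fls set" where
  "infinite_cf = {x \<in> unit_ideal. \<forall>i. (gauss_map ^^ i) x \<noteq> 0}"

text \<open>For an infinite continued fraction this is the degree of the denominator of the m-th
  convergent; it is the S_m of the overview.\<close>

definition digit_deg_sum :: "'a :: field fls \<Rightarrow> nat \<Rightarrow> nat" where
  "digit_deg_sum x m = (\<Sum>i<m. degree (digit x i))"

lemma digit_deg_sum_Suc: "digit_deg_sum x (Suc m) = digit_deg_sum x m + degree (digit x m)"
  by (simp add: digit_deg_sum_def)

lemma funpow_gauss_map_in_infinite_cf: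
  assumes "x \<in> infinite_cf"
  shows "(gauss_map ^^ m) x \<in> infinite_cf"
proof -
  have "(gauss_map ^^ i) ((gauss_map ^^ m) x) \<noteq> 0" for i
    using assms by (simp add: infinite_cf_def flip: funpow_add[THEN fun_cong, unfolded o_def])
  moreover have "(gauss_map ^^ m) x \<in> unit_ideal"
    using assms by (cases m) (simp_all add: infinite_cf_def gauss_map_in_unit_ideal)
  ultimately show ?thesis by (simp add: infinite_cf_def)
qed

lemma abs_infty_funpow_gauss_map:
  fixes x :: "'a :: {field, finite} fls"
  assumes "x \<in> infinite_cf"
  shows "abs_infty ((gauss_map ^^ i) x) = real CARD('a) powr (- degree (digit x i))"
proof -
  have "(gauss_map ^^ i) x \<in> infinite_cf" by (rule funpow_gauss_map_in_infinite_cf[OF assms])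
  then have "(gauss_map ^^ i) x \<noteq> 0" "(gauss_map ^^ i) x \<in> unit_ideal"
    by (auto simp: infinite_cf_def dest: spec[of _ 0])
  from abs_infty_eq_powr_digit[OF this] show ?thesis
    by (simp add: digit_funpow_gauss_map)
qed

text \<open>From x - y = - x y (1/x - 1/y), with both inverses split into polynomial and fractional
  part. If the first partial quotients differ, the polynomial dominates; if they agree, only the
  Gauss images remain.\<close>

lemma rho_infty_step:
  fixes x y :: "'a :: {field, finite} fls"
  assumes "x \<in> infinite_cf" "y \<in> infinite_cf"
  shows "rho_infty x y = abs_infty x * abs_infty y *
    abs_infty (poly_in_z (digit x 0 - digit y 0) + (gauss_map x - gauss_map y))"
proof -
  have nz: "x \<noteq> 0" "y \<noteq> 0"
    using assms by (auto simp: infinite_cf_def dest: spec[of _ 0])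
  have "x - y = - (x * y * (1 / x - 1 / y))"
    using nz by (simp add: field_simps)
  also have "1 / x - 1 / y = poly_in_z (digit x 0 - digit y 0) + (gauss_map x - gauss_map y)"
    using nz by (simp add: poly_in_z_diff partial_quotient_def gauss_map_def)
  finally show ?thesis by (simp add: rho_infty_def abs_infty_mult)
qed

text \<open>Iterates \<open>rho_infty_step\<close>: a common partial quotient of degree d
  contributes |x| |y| = q^(-2d). The formula is exact, so it serves both the upper and the lower
  bound.\<close>

lemma rho_infty_same_digits:
  fixes x y :: "'a :: {field, finite} fls"
  assumes "x \<in> infinite_cf" "y \<in> infinite_cf" "\<And>i. i < n \<Longrightarrow> digit x i = digit y i"
  shows "rho_infty x y = real CARD('a) powr (- 2 * real (digit_deg_sum x n)) *
    rho_infty ((gauss_map ^^ n) x) ((gauss_map ^^ n) y)"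
  using assms(3)
proof (induction n)
  case 0
  then show ?case using card_field_gt_1[where 'a = 'a] by (simp add: digit_deg_sum_def)
next
  case (Suc n)
  let ?x = "(gauss_map ^^ n) x" and ?y = "(gauss_map ^^ n) y"
  have eq: "digit x n = digit y n" using Suc.prems by simp
  have 0: "poly_in_z 0 = (0 :: 'a fls)" by simp
  have "rho_infty ?x ?y = real CARD('a) powr (- 2 * real (degree (digit x n))) *
      rho_infty (gauss_map ?x) (gauss_map ?y)"
    using rho_infty_step[OF assms(1,2)[THEN funpow_gauss_map_in_infinite_cf[of _ n]]]
    by (simp add: digit_funpow_gauss_map eq abs_infty_funpow_gauss_map assms(1,2)
        0 rho_infty_def flip: powr_add)
  then show ?case
    using Suc by (simp add: digit_deg_sum_def algebra_simps flip: powr_add)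
qed

text \<open>At the first disagreement the nonzero polynomial difference dominates the fractional
  parts. Its degree may be below that of the partial quotients, which produces scales between
  consecutive cylinders.\<close>

lemma rho_infty_first_difference:
  fixes x y :: "'a :: {field, finite} fls"
  assumes "x \<in> infinite_cf" "y \<in> infinite_cf" "\<And>i. i < n \<Longrightarrow> digit x i = digit y i"
    and "digit x n \<noteq> digit y n" "degree (digit x n) = degree (digit y n)"
  shows "rho_infty x y = real CARD('a) powr
    (- 2 * real (digit_deg_sum x (Suc n)) + real (degree (digit x n - digit y n)))"
proof -
  let ?x = "(gauss_map ^^ n) x" and ?y = "(gauss_map ^^ n) y"
  have "rho_infty ?x ?y = real CARD('a) powr
      (- 2 * real (degree (digit x n)) + real (degree (digit x n - digit y n)))"
    using rho_infty_step[OF assms(1,2)[THEN funpow_gauss_map_in_infinite_cf[of _ n]]] assms(4,5)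
    by (simp add: digit_funpow_gauss_map abs_infty_funpow_gauss_map assms(1,2)
        abs_infty_poly_in_z_add unit_ideal_diff gauss_map_in_unit_ideal flip: powr_add)
  then show ?thesis
    using rho_infty_same_digits[OF assms(1-3)]
    by (simp add: digit_deg_sum_def algebra_simps flip: powr_add)
qed

text \<open>After the common prefix both Gauss images have absolute value at most q^(-D), and so has
  their difference by the ultrametric inequality. A real \<open>D\<close> admits the value (c - 1)
  S_m used for covers.\<close>

lemma rho_infty_le:
  fixes x y :: "'a :: {field, finite} fls"
  assumes "x \<in> infinite_cf" "y \<in> infinite_cf" "\<And>i. i < n \<Longrightarrow> digit x i = digit y i"
    and "D \<le> real (degree (digit x n))" "D \<le> real (degree (digit y n))"
  shows "rho_infty x y \<le> real CARD('a) powr (- 2 * real (digit_deg_sum x n) - D)"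
proof -
  have "abs_infty ((gauss_map ^^ n) z) \<le> real CARD('a) powr (- D)"
    if "z \<in> infinite_cf" "D \<le> real (degree (digit z n))" for z :: "'a fls"
    using that card_field_gt_1[where 'a = 'a] by (simp add: abs_infty_funpow_gauss_map)
  then have "rho_infty ((gauss_map ^^ n) x) ((gauss_map ^^ n) y) \<le> real CARD('a) powr (- D)"
    unfolding rho_infty_def using assms by (intro abs_infty_diff_le) auto
  then show ?thesis
    using rho_infty_same_digits[OF assms(1-3)]
    by (simp add: powr_diff powr_minus divide_inverse mult_left_mono)
qed

subsection \<open>Counting polynomials\<close>

lemma card_degree_le:
  "finite {p :: 'a :: {field, finite} poly. degree p \<le> n}"
  "card {p :: 'a poly. degree p \<le> n} = CARD('a) ^ Suc n"
proof (induction n)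
  case 0
  have eq: "{p :: 'a poly. degree p \<le> 0} = range (\<lambda>a. [:a:])"
    by (auto elim: degree_eq_zeroE)
  show "finite {p :: 'a poly. degree p \<le> 0}" "card {p :: 'a poly. degree p \<le> 0} = CARD('a) ^ Suc 0"
    unfolding eq by (auto simp: card_image inj_on_def)
next
  case (Suc n)
  have eq: "{p :: 'a poly. degree p \<le> Suc n} = (\<lambda>(a, p). pCons a p) ` (UNIV \<times> {p. degree p \<le> n})"
  proof (intro equalityI subsetI)
    fix p :: "'a poly" assume "p \<in> {p. degree p \<le> Suc n}"
    then show "p \<in> (\<lambda>(a, p). pCons a p) ` (UNIV \<times> {p. degree p \<le> n})"
      by (cases p) (auto simp: image_iff split: if_splits)
  qed (auto split: if_splits)
  show "finite {p :: 'a poly. degree p \<le> Suc n}"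
    unfolding eq using Suc by simp
  have "inj_on (\<lambda>(a, p). pCons a p) (UNIV \<times> {p :: 'a poly. degree p \<le> n})"
    by (auto simp: inj_on_def)
  then show "card {p :: 'a poly. degree p \<le> Suc n} = CARD('a) ^ Suc (Suc n)"
    unfolding eq using Suc by (simp add: card_image card_cartesian_product)
qed

text \<open>Counts, by translation, the choices left when a partial quotient is known up to an error
  of degree \<open>n\<close>.\<close>

lemma card_degree_diff_le:
  fixes p0 :: "'a :: {field, finite} poly"
  shows "finite {p. degree (p - p0) \<le> n}" "card {p. degree (p - p0) \<le> n} = CARD('a) ^ Suc n"
proof -
  have eq: "{p. degree (p - p0) \<le> n} = (\<lambda>p. p + p0) ` {p. degree p \<le> n}"
    by (auto simp: image_iff) (metis diff_add_cancel)
  show "finite {p. degree (p - p0) \<le> n}" "card {p. degree (p - p0) \<le> n} = CARD('a) ^ Suc n"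
    unfolding eq by (simp_all add: card_degree_le card_image)
qed

text \<open>The exact number is (q - 1) q^n. The lower bound is what limits the mass of a single
  choice under the uniform distribution.\<close>

lemma card_degree_eq:
  assumes "1 \<le> n"
  shows "finite {p :: 'a :: {field, finite} poly. degree p = n}"
    "CARD('a) ^ n \<le> card {p :: 'a poly. degree p = n}"
proof -
  obtain m where m: "n = Suc m" using assms by (cases n) auto
  have eq: "{p :: 'a poly. degree p = n} = {p. degree p \<le> n} - {p. degree p \<le> m}"
    using m by auto
  show "finite {p :: 'a poly. degree p = n}"
    unfolding eq by (intro finite_Diff card_degree_le)
  have "card {p :: 'a poly. degree p = n} = CARD('a) ^ Suc n - CARD('a) ^ n"
    unfolding eq using m by (subst card_Diff_subset) (auto simp: card_degree_le)
  also have "\<dots> \<ge> CARD('a) ^ n"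
    using card_field_ge_2[where 'a = 'a] by (simp add: le_diff_conv2 mult_le_mono1 flip: mult_2)
  finally show "CARD('a) ^ n \<le> card {p :: 'a poly. degree p = n}" .
qed

lemma countable_polys: "countable (UNIV :: 'a :: {field, finite} poly set)"
  by (rule countableI'[of "to_nat \<circ> coeffs"]) (auto simp: inj_on_def coeffs_eq_iff)

text \<open>At most q^(n+1) polynomials have degree n, so sorting by degree gives a geometric series
  of ratio q^(1-t). Integrals over \<open>count_space\<close> serve as unordered sums.\<close>

lemma nn_integral_powr_degree_finite:
  fixes t :: real
  assumes "1 < t"
  shows "(\<integral>\<^sup>+p. ennreal (real CARD('a) powr (- t * degree p)) \<partial>count_space (UNIV :: 'a :: {field, finite} poly set)) < \<infinity>"
proof -
  let ?q = "real CARD('a)"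
  let ?f = "\<lambda>p :: 'a poly. ennreal (?q powr (- t * degree p))"
  have q: "1 < ?q" by (rule card_field_gt_1)
  define r where "r = ?q powr (1 - t)"
  have r: "0 \<le> r" "r < 1"
    using q assms powr_less_cancel_iff[of ?q "1 - t" 0] by (auto simp: r_def)
  have "(\<integral>\<^sup>+p. ?f p \<partial>count_space UNIV)
      = (\<integral>\<^sup>+p. (\<Sum>n. ?f p * indicator {p. degree p = n} p) \<partial>count_space UNIV)"
  proof (rule nn_integral_cong)
    fix p
    have "(\<lambda>n. ?f p * indicator {p. degree p = n} p) sums ?f p"
      using sums_single[of "degree p" "\<lambda>_. ?f p"]
      by (rule sums_cong[THEN iffD1, rotated]) (auto simp: indicator_def)
    then show "?f p = (\<Sum>n. ?f p * indicator {p. degree p = n} p)"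
      by (simp add: sums_iff)
  qed
  also have "\<dots> = (\<Sum>n. \<integral>\<^sup>+p. ?f p * indicator {p. degree p = n} p \<partial>count_space UNIV)"
    by (rule nn_integral_suminf) auto
  also have "\<dots> \<le> (\<Sum>n. ennreal (?q * r ^ n))"
  proof (intro suminf_le summableI)
    fix n
    have "(\<integral>\<^sup>+p. ?f p * indicator {p. degree p = n} p \<partial>count_space UNIV)
        \<le> (\<integral>\<^sup>+p. ennreal (?q powr (- t * n)) * indicator {p :: 'a poly. degree p \<le> n} p \<partial>count_space UNIV)"
      by (intro nn_integral_mono) (auto simp: indicator_def)
    also have "\<dots> = ennreal (?q powr (- t * n)) * of_nat (CARD('a) ^ Suc n)"
      by (subst nn_integral_cmult_indicator) (auto simp: emeasure_count_space card_degree_le)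
    also have "\<dots> = ennreal (?q powr (- t * n) * ?q ^ Suc n)"
      by (simp add: ennreal_mult ennreal_of_nat_eq_real_of_nat ennreal_power)
    also have "?q powr (- t * n) * ?q ^ Suc n = ?q * r ^ n"
      using q by (simp add: r_def algebra_simps powr_powr flip: powr_realpow powr_add)
    finally show "(\<integral>\<^sup>+p. ?f p * indicator {p. degree p = n} p \<partial>count_space UNIV) \<le> ennreal (?q * r ^ n)" .
  qed
  also have "\<dots> = ennreal (\<Sum>n. ?q * r ^ n)"
    using r by (intro suminf_ennreal2 summable_mult summable_geometric) auto
  also have "\<dots> < \<infinity>" by simp
  finally show ?thesis .
qed

subsection \<open>Sums over words\<close>

lemma nn_integral_count_space_le_UNIV:
  "(\<integral>\<^sup>+x. f x \<partial>count_space A) \<le> (\<integral>\<^sup>+x. f x \<partial>count_space UNIV)"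
proof -
  have "f x * indicator A x \<le> f x" for x
    by (cases "x \<in> A") auto
  then show ?thesis
    by (simp add: nn_integral_count_space_indicator nn_integral_mono del: indicator_simps)
qed

text \<open>Splitting off the first letter and applying Fubini, a multiplicative weight on words
  sums to a power of the sum over letters.\<close>

lemma nn_integral_lists_of_length:
  fixes w :: "'b \<Rightarrow> ennreal"
  shows "(\<integral>\<^sup>+u. prod_list (map w u) \<partial>count_space {u. length u = m}) = (\<integral>\<^sup>+p. w p \<partial>count_space UNIV) ^ m"
proof (induction m)
  case 0
  have "{u :: 'b list. length u = 0} = {[]}" by auto
  then show ?case by (simp add: nn_integral_count_space_finite)
next
  case (Suc m)
  let ?L = "{u :: 'b list. length u = m}"
  have bij: "bij_betw (\<lambda>(p, u). p # u) (UNIV \<times> ?L) {u. length u = Suc m}"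
    by (auto simp: bij_betw_def inj_on_def image_iff length_Suc_conv)
  have "(\<integral>\<^sup>+u. prod_list (map w u) \<partial>count_space {u. length u = Suc m})
      = (\<integral>\<^sup>+x. prod_list (map w (case x of (p, u) \<Rightarrow> p # u)) \<partial>count_space (UNIV \<times> ?L))"
    by (rule nn_integral_bij_count_space[OF bij, symmetric])
  also have "\<dots> = (\<integral>\<^sup>+x. (case x of (p, u) \<Rightarrow> w p * (prod_list (map w u) * indicator ?L u)) \<partial>count_space UNIV)"
    by (subst nn_integral_count_space_indicator) (auto intro!: nn_integral_cong simp: indicator_def)
  also have "\<dots> = (\<integral>\<^sup>+p. \<integral>\<^sup>+u. w p * (prod_list (map w u) * indicator ?L u) \<partial>count_space UNIV \<partial>count_space UNIV)"
    by (simp add: nn_integral_fst_count_space[symmetric])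
  also have "\<dots> = (\<integral>\<^sup>+p. w p * (\<integral>\<^sup>+u. prod_list (map w u) \<partial>count_space ?L) \<partial>count_space UNIV)"
    by (simp add: nn_integral_cmult nn_integral_count_space_indicator)
  also have "\<dots> = (\<integral>\<^sup>+p. w p \<partial>count_space UNIV) ^ Suc m"
    by (simp add: nn_integral_multc Suc)
  finally show ?case .
qed

text \<open>Grouping words by length gives a geometric series, finite once the letters have total
  weight below 1.\<close>

lemma nn_integral_lists:
  fixes w :: "'b \<Rightarrow> ennreal"
  shows "(\<integral>\<^sup>+u. prod_list (map w u) \<partial>count_space UNIV) = (\<Sum>m. (\<integral>\<^sup>+p. w p \<partial>count_space UNIV) ^ m)"
proof -
  have "(\<integral>\<^sup>+u. prod_list (map w u) \<partial>count_space UNIV)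
      = (\<integral>\<^sup>+u. (\<Sum>m. prod_list (map w u) * indicator {u. length u = m} u) \<partial>count_space UNIV)"
  proof (rule nn_integral_cong)
    fix u
    have "(\<lambda>m. prod_list (map w u) * indicator {u. length u = m} u) sums prod_list (map w u)"
      using sums_single[of "length u" "\<lambda>_. prod_list (map w u)"]
      by (rule sums_cong[THEN iffD1, rotated]) (auto simp: indicator_def)
    then show "prod_list (map w u) = (\<Sum>m. prod_list (map w u) * indicator {u. length u = m} u)"
      by (simp add: sums_iff)
  qed
  also have "\<dots> = (\<Sum>m. \<integral>\<^sup>+u. prod_list (map w u) * indicator {u. length u = m} u \<partial>count_space UNIV)"
    by (rule nn_integral_suminf) auto
  also have "\<dots> = (\<Sum>m. (\<integral>\<^sup>+p. w p \<partial>count_space UNIV) ^ m)"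
    by (simp add: nn_integral_count_space_indicator[symmetric] nn_integral_lists_of_length)
  finally show ?thesis .
qed

subsection \<open>The upper bound\<close>

lemma diam_wrt_le:
  assumes "\<And>x y. x \<in> U \<Longrightarrow> y \<in> U \<Longrightarrow> d x y \<le> r"
  shows "diam_wrt d U \<le> ennreal r"
  unfolding diam_wrt_def using assms by (intro SUP_least ennreal_leI)

text \<open>Covers below are indexed by words, while the definition uses sequences of sets; an
  enumeration converts one into the other.\<close>

lemma hausdorff_premeasure_le:
  assumes "countable A" "E \<subseteq> (\<Union>a\<in>A. U a)" "\<And>a. a \<in> A \<Longrightarrow> diam_wrt d (U a) \<le> ennreal \<delta>"
  shows "hausdorff_premeasure d s \<delta> E
    \<le> (\<integral>\<^sup>+a. ennreal (enn2real (diam_wrt d (U a)) powr s) \<partial>count_space A)"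
proof -
  let ?N = "to_nat_on A ` A"
  let ?f = "\<lambda>X. ennreal (enn2real (diam_wrt d X) powr s)"
  define V where "V i = (if i \<in> ?N then U (from_nat_into A i) else {})" for i
  have empty: "diam_wrt d {} = 0" by (simp add: diam_wrt_def bot_ennreal)
  have V: "V (to_nat_on A a) = U a" if "a \<in> A" for a
    using that assms(1) by (simp add: V_def)
  have "E \<subseteq> (\<Union>i. V i)"
  proof
    fix x assume "x \<in> E"
    then obtain a where "a \<in> A" "x \<in> U a" using assms(2) by auto
    then show "x \<in> (\<Union>i. V i)" using V by blast
  qed
  moreover have "diam_wrt d (V i) \<le> ennreal \<delta>" for i
  proof (cases "i \<in> ?N")
    case True
    then show ?thesis using assms(3) V by auto
  qed (simp add: V_def empty)
  ultimately have "hausdorff_premeasure d s \<delta> E \<le> (\<Sum>i. ?f (V i))"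
    unfolding hausdorff_premeasure_def by (intro INF_lower) auto
  also have "\<dots> = (\<integral>\<^sup>+i. ?f (V i) \<partial>count_space UNIV)"
    by (rule nn_integral_count_space_nat[symmetric])
  also have "\<dots> = (\<integral>\<^sup>+i. ?f (V i) \<partial>count_space ?N)"
    by (subst (2) nn_integral_count_space_indicator)
      (auto intro!: nn_integral_cong simp: indicator_def V_def empty)
  also have "\<dots> = (\<integral>\<^sup>+a. ?f (V (to_nat_on A a)) \<partial>count_space A)"
    using assms(1) by (intro nn_integral_bij_count_space[symmetric]) (simp add: bij_betw_def inj_on_to_nat_on)
  also have "\<dots> = (\<integral>\<^sup>+a. ?f (U a) \<partial>count_space A)"
    by (intro nn_integral_cong) (simp add: V)
  finally show ?thesis .
qed

lemma prod_list_powr_degree: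
  fixes u :: "'a :: {field, finite} poly list" and t :: real
  assumes "0 \<le> \<kappa>"
  shows "prod_list (map (\<lambda>p. ennreal (\<kappa> * real CARD('a) powr (- t * degree p))) u)
    = ennreal (\<kappa> ^ length u * real CARD('a) powr (- t * sum_list (map degree u)))"
proof (induction u)
  case Nil
  then show ?case using card_field_gt_1[where 'a = 'a] by simp
next
  case (Cons p u)
  have "real CARD('a) powr (- t * (degree p + sum_list (map degree u)))
      = real CARD('a) powr (- t * degree p) * real CARD('a) powr (- t * sum_list (map degree u))"
    by (simp add: algebra_simps flip: powr_add)
  then show ?case
    using Cons assms by (simp add: ac_simps flip: ennreal_mult)
qed

text \<open>A point is covered at its jumps by the word read so far. The surplus of s (c + 1) over 1
  pays for the convergence of the sum over letters and, since S_m outgrows every multiple of m, for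
  the length of the words.\<close>

lemma hausdorff_measure_eq_0:
  fixes E :: "'a :: {field, finite} fls set" and c s :: real
  assumes "E \<subseteq> infinite_cf" and "1 \<le> c" and "1 / (c + 1) < s"
    and growth: "\<And>M :: nat. \<exists>m0. \<forall>x\<in>E. \<forall>m\<ge>m0. M * m \<le> digit_deg_sum x m"
    and jump: "\<And>x m0. x \<in> E \<Longrightarrow> \<exists>m\<ge>m0. c * digit_deg_sum x m \<le> digit_deg_sum x (Suc m)"
  shows "hausdorff_measure rho_infty s E = 0"
proof -
  let ?q = "real CARD('a)"
  let ?\<sigma> = "\<lambda>u :: 'a poly list. sum_list (map degree u)"
  have q: "1 < ?q" by (rule card_field_gt_1)
  \<comment> \<open>Thus s (c + 1) = 1 + 2 \<epsilon>: one \<epsilon> makes the sum \<open>Z\<close>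
    over letters converge, the other becomes the factor \<open>\<kappa>\<close> per letter.\<close>
  define \<epsilon> where "\<epsilon> = (s * (c + 1) - 1) / 2"
  have \<epsilon>: "0 < \<epsilon>" using assms(2,3) by (simp add: \<epsilon>_def field_simps)
  have s: "0 < s" using assms(2,3) by (smt (verit) divide_pos_pos)
  define Z where "Z = enn2real (\<integral>\<^sup>+p. ennreal (?q powr (- (1 + \<epsilon>) * degree p)) \<partial>count_space (UNIV :: 'a poly set))"
  have Z: "(\<integral>\<^sup>+p. ennreal (?q powr (- (1 + \<epsilon>) * degree p)) \<partial>count_space (UNIV :: 'a poly set)) = ennreal Z"
    unfolding Z_def using nn_integral_powr_degree_finite[of "1 + \<epsilon>", where 'a = 'a] \<epsilon>
    by (simp add: less_top[symmetric])
  have Z0: "0 \<le> Z" by (simp add: Z_def)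
  \<comment> \<open>\<open>M\<close> is chosen so that Z \<kappa> < 1/4; the geometric series over
    words then converges even with an extra factor 2 per letter.\<close>
  have "(\<lambda>M :: nat. Z * (?q powr (- \<epsilon>)) ^ M) \<longlonglongrightarrow> Z * 0"
    using q \<epsilon> powr_less_cancel_iff[of ?q "- \<epsilon>" 0] by (intro tendsto_mult LIMSEQ_power_zero) auto
  then have "\<forall>\<^sub>F M in sequentially. Z * (?q powr (- \<epsilon>)) ^ M < 1 / 4"
    by (rule order_tendstoD) simp
  then have "\<forall>\<^sub>F M in sequentially. 1 \<le> M \<and> Z * (?q powr (- \<epsilon>)) ^ M < 1 / 4"
    using eventually_ge_at_top[of 1] by eventually_elim simp
  then obtain M :: nat where M: "1 \<le> M" "Z * (?q powr (- \<epsilon>)) ^ M < 1 / 4"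
    by (auto simp: eventually_sequentially)
  define \<kappa> where "\<kappa> = ?q powr (- \<epsilon> * M)"
  have \<kappa>: "0 < \<kappa>" "Z * \<kappa> < 1 / 4"
    using M q by (auto simp: \<kappa>_def powr_power mult.commute)
  obtain m0 where m0: "\<And>x m. x \<in> E \<Longrightarrow> m0 \<le> m \<Longrightarrow> M * m \<le> digit_deg_sum x m"
    using growth[of M] by blast
  \<comment> \<open>Cylinders cut down to the points that jump right after the word. With S the
    degree of the word, the jump improves the diameter bound from q^(-2S) to q^(-(c+1)S).\<close>
  define U where "U u = {x \<in> E. (\<forall>i<length u. digit x i = u ! i) \<and>
    c * digit_deg_sum x (length u) \<le> digit_deg_sum x (Suc (length u))}" for u
  have U_sum: "digit_deg_sum x (length u) = ?\<sigma> u" if "x \<in> U u" for x u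
    using that by (simp add: U_def digit_deg_sum_def sum_list_sum_nth atLeast0LessThan)
  have diam: "diam_wrt rho_infty (U u) \<le> ennreal (?q powr (- (c + 1) * ?\<sigma> u))" for u
  proof (rule diam_wrt_le)
    fix x y assume xy: "x \<in> U u" "y \<in> U u"
    have *: "(c - 1) * ?\<sigma> u \<le> real (degree (digit z (length u)))" if "z \<in> U u" for z
    proof -
      have "c * digit_deg_sum z (length u) \<le> digit_deg_sum z (Suc (length u))"
        using that by (simp add: U_def)
      then show ?thesis
        using U_sum[OF that] by (simp add: digit_deg_sum_Suc algebra_simps)
    qed
    have "rho_infty x y \<le> ?q powr (- 2 * real (digit_deg_sum x (length u)) - (c - 1) * ?\<sigma> u)"
      using xy * assms(1) by (intro rho_infty_le) (auto simp: U_def)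
    also have "- 2 * real (digit_deg_sum x (length u)) - (c - 1) * ?\<sigma> u = - (c + 1) * ?\<sigma> u"
      using U_sum[OF xy(1)] by (simp add: algebra_simps)
    finally show "rho_infty x y \<le> ?q powr (- (c + 1) * ?\<sigma> u)" .
  qed
  \<comment> \<open>The growth is inherited from a point of \<open>U u\<close>, hence available only
    for words that occur; empty sets contribute 0.\<close>
  have growth_U: "M * length u \<le> ?\<sigma> u" if "U u \<noteq> {}" "m0 \<le> length u" for u
    using that m0 U_sum by (metis (no_types, lifting) U_def ex_in_conv mem_Collect_eq)
  have weight: "ennreal (enn2real (diam_wrt rho_infty (U u)) powr s)
      \<le> prod_list (map (\<lambda>p. ennreal (\<kappa> * ?q powr (- (1 + \<epsilon>) * degree p))) u)"
    if "m0 \<le> length u" for u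
  proof (cases "U u = {}")
    case True
    then show ?thesis by (simp add: diam_wrt_def bot_ennreal)
  next
    case False
    have "enn2real (diam_wrt rho_infty (U u)) \<le> ?q powr (- (c + 1) * ?\<sigma> u)"
      using diam[of u] by (intro enn2real_leI) auto
    then have "enn2real (diam_wrt rho_infty (U u)) powr s \<le> (?q powr (- (c + 1) * ?\<sigma> u)) powr s"
      using s by (intro powr_mono2) auto
    also have "\<dots> = ?q powr (- \<epsilon> * ?\<sigma> u) * ?q powr (- (1 + \<epsilon>) * ?\<sigma> u)"
    proof -
      have "(- (c + 1) * ?\<sigma> u) * s = - \<epsilon> * ?\<sigma> u + - (1 + \<epsilon>) * ?\<sigma> u"
        by (simp add: \<epsilon>_def field_simps)
      then show ?thesis by (simp only: powr_powr powr_add)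
    qed
    \<comment> \<open>Here the second \<epsilon> is spent: S >= M m bounds q^(-\<epsilon> S) by
      \<kappa>^m for words of length m.\<close>
    also have "\<dots> \<le> \<kappa> ^ length u * ?q powr (- (1 + \<epsilon>) * ?\<sigma> u)"
    proof (rule mult_right_mono)
      have "real (M * length u) \<le> real (?\<sigma> u)"
        using growth_U[OF False that] by (rule of_nat_mono)
      then show "?q powr (- \<epsilon> * ?\<sigma> u) \<le> \<kappa> ^ length u"
        using \<epsilon> q by (simp add: \<kappa>_def powr_power ac_simps)
    qed simp
    finally show ?thesis
      unfolding prod_list_powr_degree[OF less_imp_le[OF \<kappa>(1)]] by (rule ennreal_leI)
  qed
  \<comment> \<open>Jumps occur arbitrarily late, so words of length at least \<open>m\<close>
    already cover \<open>E\<close>, and large \<open>m\<close> makes the cover fine.\<close>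
  have bound: "hausdorff_premeasure rho_infty s \<delta> E \<le> ennreal (2 * (1 / 2) ^ m)"
    if m: "m0 \<le> m" "?q powr (- real m) \<le> \<delta>" for m \<delta>
  proof -
    let ?A = "{u :: 'a poly list. m \<le> length u}"
    have "0 < \<delta>" using m(2) q by (smt (verit) powr_gt_zero)
    have "hausdorff_premeasure rho_infty s \<delta> E
        \<le> (\<integral>\<^sup>+u. ennreal (enn2real (diam_wrt rho_infty (U u)) powr s) \<partial>count_space ?A)"
    proof (rule hausdorff_premeasure_le)
      have "countable (lists (UNIV :: 'a poly set))"
        by (intro countable_lists countable_polys)
      then show "countable ?A" by (rule countable_subset[rotated]) auto
      show "E \<subseteq> (\<Union>u\<in>?A. U u)"
      proof
        fix x assume x: "x \<in> E"
        obtain n where n: "m \<le> n" "c * digit_deg_sum x n \<le> digit_deg_sum x (Suc n)"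
          using jump[OF x] by blast
        then have "x \<in> U (map (digit x) [0..<n])" using x by (simp add: U_def)
        then show "x \<in> (\<Union>u\<in>?A. U u)" using n(1) by (intro UN_I[of "map (digit x) [0..<n]"]) auto
      qed
      fix u assume u: "u \<in> ?A"
      show "diam_wrt rho_infty (U u) \<le> ennreal \<delta>"
      proof (cases "U u = {}")
        case True
        then show ?thesis by (simp add: diam_wrt_def bot_ennreal)
      next
        case False
        have "1 * m \<le> M * length u" using u M(1) by (intro mult_mono) auto
        then have "m \<le> ?\<sigma> u" using growth_U[OF False] u m(1) by simp
        then have "1 * real m \<le> (c + 1) * real (?\<sigma> u)"
          using assms(2) by (intro mult_mono) auto
        then have "?q powr (- (c + 1) * ?\<sigma> u) \<le> ?q powr (- real m)"
          using q by (simp add: algebra_simps)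
        then show ?thesis
          using diam[of u] m(2) by (meson ennreal_leI order_trans)
      qed
    qed
    also have "\<dots> \<le> (\<integral>\<^sup>+u. ennreal ((1 / 2) ^ m) *
        prod_list (map (\<lambda>p. ennreal (2 * \<kappa> * ?q powr (- (1 + \<epsilon>) * degree p))) u) \<partial>count_space ?A)"
    proof (rule nn_integral_mono)
      fix u :: "'a poly list" assume "u \<in> space (count_space ?A)"
      then have u: "m \<le> length u" by simp
      \<comment> \<open>The spare factor 2 per letter is exchanged for (1/2)^m, which sends the
        total to 0 as \<open>m\<close> grows.\<close>
      have "\<kappa> ^ length u \<le> (1 / 2) ^ m * (2 * \<kappa>) ^ length u"
      proof -
        have "(1 / 2 :: real) ^ length u \<le> (1 / 2) ^ m" using u by (intro power_decreasing) auto
        then have "(1 / 2) ^ length u * (2 * \<kappa>) ^ length u \<le> (1 / 2) ^ m * (2 * \<kappa>) ^ length u"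
          using \<kappa>(1) by (intro mult_right_mono) auto
        then show ?thesis by (simp add: power_mult_distrib power_one_over)
      qed
      then have *: "\<kappa> ^ length u * ?q powr (- (1 + \<epsilon>) * ?\<sigma> u)
          \<le> (1 / 2) ^ m * ((2 * \<kappa>) ^ length u * ?q powr (- (1 + \<epsilon>) * ?\<sigma> u))"
        unfolding mult.assoc[symmetric] by (rule mult_right_mono) simp
      have "ennreal (enn2real (diam_wrt rho_infty (U u)) powr s)
          \<le> prod_list (map (\<lambda>p. ennreal (\<kappa> * ?q powr (- (1 + \<epsilon>) * degree p))) u)"
        using m(1) u by (intro weight) simp
      also have "\<dots> = ennreal (\<kappa> ^ length u * ?q powr (- (1 + \<epsilon>) * ?\<sigma> u))"
        using \<kappa>(1) by (intro prod_list_powr_degree) simp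
      also have "\<dots> \<le> ennreal ((1 / 2) ^ m * ((2 * \<kappa>) ^ length u * ?q powr (- (1 + \<epsilon>) * ?\<sigma> u)))"
        using * by (rule ennreal_leI)
      also have "\<dots> = ennreal ((1 / 2) ^ m) * ennreal ((2 * \<kappa>) ^ length u * ?q powr (- (1 + \<epsilon>) * ?\<sigma> u))"
        using \<kappa>(1) by (intro ennreal_mult) simp_all
      also have "ennreal ((2 * \<kappa>) ^ length u * ?q powr (- (1 + \<epsilon>) * ?\<sigma> u))
          = prod_list (map (\<lambda>p. ennreal (2 * \<kappa> * ?q powr (- (1 + \<epsilon>) * degree p))) u)"
        using \<kappa>(1) by (intro prod_list_powr_degree[symmetric]) simp
      finally show "ennreal (enn2real (diam_wrt rho_infty (U u)) powr s) \<le> ennreal ((1 / 2) ^ m) *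
          prod_list (map (\<lambda>p. ennreal (2 * \<kappa> * ?q powr (- (1 + \<epsilon>) * degree p))) u)" .
    qed
    also have "\<dots> \<le> (\<integral>\<^sup>+u. ennreal ((1 / 2) ^ m) *
        prod_list (map (\<lambda>p. ennreal (2 * \<kappa> * ?q powr (- (1 + \<epsilon>) * degree p))) u) \<partial>count_space (UNIV :: 'a poly list set))"
      by (rule nn_integral_count_space_le_UNIV)
    also have "\<dots> = ennreal ((1 / 2) ^ m) *
        (\<Sum>n. (\<integral>\<^sup>+p. ennreal (2 * \<kappa> * ?q powr (- (1 + \<epsilon>) * degree (p :: 'a poly))) \<partial>count_space UNIV) ^ n)"
      by (simp add: nn_integral_cmult nn_integral_lists)
    also have "(\<integral>\<^sup>+p. ennreal (2 * \<kappa> * ?q powr (- (1 + \<epsilon>) * degree (p :: 'a poly))) \<partial>count_space UNIV)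
        = ennreal (2 * \<kappa> * Z)"
      using \<kappa>(1) Z Z0 by (simp add: ennreal_mult nn_integral_cmult)
    also have "(\<Sum>n. ennreal (2 * \<kappa> * Z) ^ n) \<le> (\<Sum>n. ennreal ((1 / 2) ^ n))"
      using \<kappa> Z0 by (intro suminf_le summableI) (auto simp: ennreal_power mult.commute intro!: ennreal_leI power_mono)
    also have "\<dots> = ennreal (\<Sum>n. (1 / 2) ^ n)"
      by (intro suminf_ennreal2) (auto simp: summable_geometric)
    also have "(\<Sum>n. (1 / 2 :: real) ^ n) = 2"
      by (subst suminf_geometric) auto
    also have "ennreal ((1 / 2) ^ m) * ennreal 2 = ennreal (2 * (1 / 2) ^ m)"
      by (subst ennreal_mult[symmetric]) (simp_all add: mult.commute)
    finally show ?thesis by (simp add: mult_left_mono)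
  qed
  have "hausdorff_premeasure rho_infty s \<delta> E = 0" if "0 < \<delta>" for \<delta>
  proof -
    have "(\<lambda>m. (?q powr (-1)) ^ m) \<longlonglongrightarrow> 0"
      using q powr_less_cancel_iff[of ?q "-1" 0] by (intro LIMSEQ_power_zero) auto
    then have "\<forall>\<^sub>F m in sequentially. (?q powr (-1)) ^ m < \<delta>"
      using that by (rule order_tendstoD)
    then have "\<forall>\<^sub>F m in sequentially. hausdorff_premeasure rho_infty s \<delta> E \<le> ennreal (2 * (1 / 2) ^ m)"
      using eventually_ge_at_top[of m0]
    proof eventually_elim
      case (elim m)
      then show ?case using q by (intro bound) (auto simp: powr_minus_divide powr_realpow power_one_over)
    qed
    moreover have "(\<lambda>m. ennreal (2 * (1 / 2) ^ m)) \<longlonglongrightarrow> ennreal (2 * 0)"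
      by (intro tendsto_ennrealI tendsto_mult tendsto_const LIMSEQ_power_zero) auto
    ultimately have "hausdorff_premeasure rho_infty s \<delta> E \<le> ennreal (2 * 0)"
      by (intro tendsto_lowerbound) auto
    then show ?thesis by simp
  qed
  then show ?thesis
    unfolding hausdorff_measure_def by (simp add: SUP_eq_const)
qed

subsection \<open>Points with prescribed partial quotients\<close>

lemma abs_infty_inverse_poly_in_z_add:
  fixes p :: "'a :: {field, finite} poly"
  assumes "1 \<le> degree p" "y \<in> unit_ideal"
  shows "abs_infty (1 / (poly_in_z p + y)) = real CARD('a) powr (- degree p)"
    "1 / (poly_in_z p + y) \<in> unit_ideal"
proof -
  have "p \<noteq> 0" using assms(1) by auto
  then show *: "abs_infty (1 / (poly_in_z p + y)) = real CARD('a) powr (- degree p)"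
    using assms(2) by (simp add: abs_infty_div abs_infty_poly_in_z_add powr_minus_divide)
  show "1 / (poly_in_z p + y) \<in> unit_ideal"
    unfolding unit_ideal_def mem_Collect_eq *
    using assms(1) card_field_gt_1[where 'a = 'a] powr_less_cancel_iff[of "real CARD('a)" "- degree p" 0] by simp
qed

text \<open>On I all values p + y have absolute value q^(deg p), so y -> 1/(p + y) contracts by an
  exact factor. This drives the convergence below.\<close>

lemma abs_infty_diff_inverse_poly_in_z_add:
  fixes p :: "'a :: {field, finite} poly"
  assumes "1 \<le> degree p" "y \<in> unit_ideal" "y' \<in> unit_ideal"
  shows "abs_infty (1 / (poly_in_z p + y) - 1 / (poly_in_z p + y'))
    = real CARD('a) powr (- 2 * degree p) * abs_infty (y - y')"
proof -
  let ?u = "poly_in_z p + y" and ?v = "poly_in_z p + y'"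
  have "p \<noteq> 0" using assms(1) by auto
  then have "0 < abs_infty ?u" "0 < abs_infty ?v"
    using assms card_field_gt_1[where 'a = 'a]
    by (simp_all add: abs_infty_poly_in_z_add del: abs_infty_pos_iff)
  then have nz: "?u \<noteq> 0" "?v \<noteq> 0" by simp_all
  have "1 / ?u - 1 / ?v = (1 / ?u) * (1 / ?v) * - (y - y')"
    using nz by (simp add: field_simps)
  then have "abs_infty (1 / ?u - 1 / ?v) = abs_infty (1 / ?u) * abs_infty (1 / ?v) * abs_infty (y - y')"
    by (simp only: abs_infty_mult abs_infty_minus)
  also have "abs_infty (1 / ?u) * abs_infty (1 / ?v) = real CARD('a) powr (- 2 * degree p)"
    using assms by (simp only: abs_infty_inverse_poly_in_z_add(1) flip: powr_add) simp
  finally show ?thesis .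
qed

text \<open>The convergent with the first n letters. The recursion peels off the first letter, so
  that each step is one of the contractions above.\<close>

primrec cf_approx :: "nat \<Rightarrow> (nat \<Rightarrow> 'a :: field poly) \<Rightarrow> 'a fls" where
  "cf_approx 0 \<omega> = 0"
| "cf_approx (Suc n) \<omega> = 1 / (poly_in_z (\<omega> 0) + cf_approx n (\<lambda>i. \<omega> (Suc i)))"

text \<open>The limit of the convergents, written down explicitly: for letters of positive degree,
  coefficient \<open>j\<close> is final from the j-th convergent on.\<close>

definition cf_value :: "(nat \<Rightarrow> 'a :: field poly) \<Rightarrow> 'a fls" where
  "cf_value \<omega> = fps_to_fls (Abs_fps (\<lambda>j. fls_nth (cf_approx j \<omega>) (int j)))"

section \<open>Convergence of the approximants\<close>

lemma cf_approx_in_unit_ideal: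
  fixes \<omega> :: "nat \<Rightarrow> 'a :: {field, finite} poly"
  assumes "\<And>i. 1 \<le> degree (\<omega> i)"
  shows "cf_approx n \<omega> \<in> unit_ideal"
  using assms
  by (induction n arbitrary: \<omega>) (auto simp: abs_infty_inverse_poly_in_z_add(2) simp del: One_nat_def)

text \<open>Each of the \<open>n\<close> shared letters contracts by at least q^(-2), of which
  q^(-1) is used; the remaining distance is below 1, hence at most q^(-1).\<close>

lemma abs_infty_cf_approx_diff_le:
  fixes \<omega> :: "nat \<Rightarrow> 'a :: {field, finite} poly"
  assumes "\<And>i. 1 \<le> degree (\<omega> i)"
  shows "abs_infty (cf_approx (n + m) \<omega> - cf_approx n \<omega>) \<le> real CARD('a) powr (- of_int (int n + 1))"
  using assms
proof (induction n arbitrary: \<omega>)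
  case 0
  then show ?case
    using cf_approx_in_unit_ideal[of \<omega> m] unfolding abs_infty_le_iff_nth by (simp add: unit_ideal_iff_nth)
next
  case (Suc n)
  let ?q = "real CARD('a)" and ?\<omega> = "\<lambda>i. \<omega> (Suc i)"
  have q: "1 < ?q" by (rule card_field_gt_1)
  have "abs_infty (cf_approx (Suc n + m) \<omega> - cf_approx (Suc n) \<omega>)
      = ?q powr (- 2 * degree (\<omega> 0)) * abs_infty (cf_approx (n + m) ?\<omega> - cf_approx n ?\<omega>)"
    using Suc.prems by (simp add: abs_infty_diff_inverse_poly_in_z_add cf_approx_in_unit_ideal)
  also have "\<dots> \<le> ?q powr (- 1) * ?q powr (- of_int (int n + 1))"
  proof (rule mult_mono)
    show "?q powr (- 2 * degree (\<omega> 0)) \<le> ?q powr (- 1)"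
      using Suc.prems[of 0] q by (intro powr_mono) linarith+
    show "abs_infty (cf_approx (n + m) ?\<omega> - cf_approx n ?\<omega>) \<le> ?q powr (- of_int (int n + 1))"
      using Suc.prems by (intro Suc.IH)
  qed auto
  also have "\<dots> = ?q powr (- of_int (int (Suc n) + 1))"
    unfolding powr_add[symmetric] by simp
  finally show ?case .
qed

lemma cf_value_in_unit_ideal: "cf_value \<omega> \<in> unit_ideal"
  by (auto simp: unit_ideal_iff_nth cf_value_def)

text \<open>For 0 <= j <= n, coefficient j is copied from the j-th convergent, and the n-th
  convergent agrees with it there.\<close>

lemma abs_infty_cf_value_diff_le:
  fixes \<omega> :: "nat \<Rightarrow> 'a :: {field, finite} poly"
  assumes "\<And>i. 1 \<le> degree (\<omega> i)"
  shows "abs_infty (cf_value \<omega> - cf_approx n \<omega>) \<le> real CARD('a) powr (- of_int (int n + 1))"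
  unfolding abs_infty_le_iff_nth
proof (intro allI impI)
  fix j :: int assume j: "j < int n + 1"
  show "fls_nth (cf_value \<omega> - cf_approx n \<omega>) j = 0"
  proof (cases "j < 0")
    case True
    then show ?thesis
      using cf_approx_in_unit_ideal[of \<omega> n, OF assms] by (simp add: cf_value_def unit_ideal_iff_nth)
  next
    case False
    then obtain m where m: "n = nat j + m" using j by (metis le_add_diff_inverse nat_le_iff zle_add1_eq_le)
    have "fls_nth (cf_approx n \<omega> - cf_approx (nat j) \<omega>) j = 0"
      using abs_infty_cf_approx_diff_le[OF assms, of "nat j" m] False
      unfolding m abs_infty_le_iff_nth by simp
    then show ?thesis using False by (simp add: cf_value_def)
  qed
qed

text \<open>Both sides are close to the convergent of order n + 1; taking n = \<open>nat j\<close>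
  makes the error too small to affect coefficient \<open>j\<close>.\<close>

lemma cf_value_Suc:
  fixes \<omega> :: "nat \<Rightarrow> 'a :: {field, finite} poly"
  assumes "\<And>i. 1 \<le> degree (\<omega> i)"
  shows "cf_value \<omega> = 1 / (poly_in_z (\<omega> 0) + cf_value (\<lambda>i. \<omega> (Suc i)))"
proof (rule fls_eqI)
  fix j
  let ?q = "real CARD('a)" and ?\<omega> = "\<lambda>i. \<omega> (Suc i)"
  let ?y = "1 / (poly_in_z (\<omega> 0) + cf_value ?\<omega>)"
  let ?n = "nat j"
  have q: "1 < ?q" by (rule card_field_gt_1)
  have "abs_infty (?y - cf_approx (Suc ?n) \<omega>)
      = ?q powr (- 2 * degree (\<omega> 0)) * abs_infty (cf_value ?\<omega> - cf_approx ?n ?\<omega>)"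
    using assms by (simp add: abs_infty_diff_inverse_poly_in_z_add cf_approx_in_unit_ideal cf_value_in_unit_ideal)
  also have "\<dots> \<le> 1 * ?q powr (- of_int (int ?n + 1))"
    using q powr_mono[of "- 2 * degree (\<omega> 0)" 0 ?q]
    by (intro mult_mono abs_infty_cf_value_diff_le assms) simp_all
  finally have "abs_infty (?y - cf_approx (Suc ?n) \<omega>) \<le> ?q powr (- of_int (int ?n + 1))" by simp
  moreover have "abs_infty (cf_value \<omega> - cf_approx (Suc ?n) \<omega>) \<le> ?q powr (- of_int (int (Suc ?n) + 1))"
    by (intro abs_infty_cf_value_diff_le assms)
  ultimately have "fls_nth (?y - cf_approx (Suc ?n) \<omega>) j = 0"
    "fls_nth (cf_value \<omega> - cf_approx (Suc ?n) \<omega>) j = 0"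
    unfolding abs_infty_le_iff_nth by auto
  then show "fls_nth (cf_value \<omega>) j = fls_nth ?y j" by simp
qed

section \<open>Partial quotients of the constructed point\<close>

lemma cf_value_nonzero:
  fixes \<omega> :: "nat \<Rightarrow> 'a :: {field, finite} poly"
  assumes "\<And>i. 1 \<le> degree (\<omega> i)"
  shows "cf_value \<omega> \<noteq> 0"
proof -
  have "0 < abs_infty (cf_value \<omega>)"
    using card_field_gt_1[where 'a = 'a]
    by (subst cf_value_Suc[OF assms], subst abs_infty_inverse_poly_in_z_add(1))
      (simp_all add: assms cf_value_in_unit_ideal del: One_nat_def)
  then show ?thesis by simp
qed

text \<open>\<open>cf_value_Suc\<close> displays the inverse as a polynomial plus an element of I,
  and this splitting is unique; so the Gauss map acts as the shift on sequences.\<close>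

lemma int_part_inverse_cf_value:
  fixes \<omega> :: "nat \<Rightarrow> 'a :: {field, finite} poly"
  assumes "\<And>i. 1 \<le> degree (\<omega> i)"
  shows "int_part (1 / cf_value \<omega>) = \<omega> 0"
    "gauss_map (cf_value \<omega>) = cf_value (\<lambda>i. \<omega> (Suc i))"
proof -
  have inv: "1 / cf_value \<omega> = poly_in_z (\<omega> 0) + cf_value (\<lambda>i. \<omega> (Suc i))"
    by (subst cf_value_Suc[OF assms]) simp
  show *: "int_part (1 / cf_value \<omega>) = \<omega> 0"
    unfolding inv by (rule int_part_poly_in_z_add[OF cf_value_in_unit_ideal])
  show "gauss_map (cf_value \<omega>) = cf_value (\<lambda>i. \<omega> (Suc i))"
    using cf_value_nonzero[OF assms] unfolding gauss_map_def * by (simp add: inv)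
qed

lemma funpow_gauss_map_cf_value:
  fixes \<omega> :: "nat \<Rightarrow> 'a :: {field, finite} poly"
  assumes "\<And>i. 1 \<le> degree (\<omega> i)"
  shows "(gauss_map ^^ m) (cf_value \<omega>) = cf_value (\<lambda>i. \<omega> (i + m))"
  using assms by (induction m) (simp_all add: int_part_inverse_cf_value(2))

lemma digit_cf_value:
  fixes \<omega> :: "nat \<Rightarrow> 'a :: {field, finite} poly"
  assumes "\<And>i. 1 \<le> degree (\<omega> i)"
  shows "digit (cf_value \<omega>) i = \<omega> i"
  using assms by (simp add: partial_quotient_def funpow_gauss_map_cf_value int_part_inverse_cf_value(1))

lemma cf_value_in_infinite_cf:
  fixes \<omega> :: "nat \<Rightarrow> 'a :: {field, finite} poly"
  assumes "\<And>i. 1 \<le> degree (\<omega> i)"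
  shows "cf_value \<omega> \<in> infinite_cf"
  using assms by (simp add: infinite_cf_def cf_value_in_unit_ideal funpow_gauss_map_cf_value cf_value_nonzero)

subsection \<open>The lower bound\<close>

lemma hausdorff_measure_mono:
  assumes "E \<subseteq> E'"
  shows "hausdorff_measure d s E \<le> hausdorff_measure d s E'"
  unfolding hausdorff_measure_def hausdorff_premeasure_def
  using assms by (intro SUP_mono' INF_superset_mono) auto

text \<open>
  Mass distribution principle. The sets \<open>C\<close> stand in for the preimages of \<open>U\<close>, so \<open>X\<close>
  need not be measurable.
\<close>
lemma mass_distribution_principle:
  assumes "prob_space P" and "X ` space P \<subseteq> E" and "0 < K"
    and cover: "\<And>U. diam_wrt d U \<le> 1 \<Longrightarrow> \<exists>C\<in>sets P. {\<omega>\<in>space P. X \<omega> \<in> U} \<subseteq> C \<and>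
      emeasure P C \<le> ennreal (K * enn2real (diam_wrt d U) powr s)"
  shows "hausdorff_measure d s E \<noteq> 0"
proof -
  interpret prob_space P by fact
  \<comment> \<open>One scale suffices, since the Hausdorff measure is a supremum over scales; 1 is
    the bound in \<open>cover\<close>.\<close>
  have "ennreal (1 / K) \<le> hausdorff_premeasure d s 1 E"
    unfolding hausdorff_premeasure_def
  proof (rule INF_greatest)
    fix U :: "nat \<Rightarrow> _"
    assume "U \<in> {U. E \<subseteq> (\<Union>i. U i) \<and> (\<forall>i. diam_wrt d (U i) \<le> ennreal 1)}"
    then have U: "E \<subseteq> (\<Union>i. U i)" "\<And>i. diam_wrt d (U i) \<le> 1" by auto
    obtain C where C: "\<And>i. C i \<in> sets P" "\<And>i. {\<omega>\<in>space P. X \<omega> \<in> U i} \<subseteq> C i"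
      "\<And>i. emeasure P (C i) \<le> ennreal (K * enn2real (diam_wrt d (U i)) powr s)"
      using cover[OF U(2)] by metis
    have "space P \<subseteq> (\<Union>i. C i)"
    proof
      fix \<omega> assume \<omega>: "\<omega> \<in> space P"
      then obtain i where "X \<omega> \<in> U i" using U(1) assms(2) by blast
      then show "\<omega> \<in> (\<Union>i. C i)" using C(2) \<omega> by blast
    qed
    then have "emeasure P (space P) \<le> emeasure P (\<Union>i. C i)"
      using C(1) by (intro emeasure_mono) auto
    then have "1 \<le> emeasure P (\<Union>i. C i)" by (simp add: emeasure_space_1)
    also have "\<dots> \<le> (\<Sum>i. emeasure P (C i))"
      using C(1) by (intro emeasure_subadditive_countably) auto
    also have "\<dots> \<le> (\<Sum>i. ennreal K * ennreal (enn2real (diam_wrt d (U i)) powr s))"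
      using C(3) assms(3) by (intro suminf_le summableI) (simp add: ennreal_mult)
    also have "\<dots> = ennreal K * (\<Sum>i. ennreal (enn2real (diam_wrt d (U i)) powr s))"
      by (rule ennreal_suminf_cmult)
    finally have "ennreal (1 / K) * 1 \<le> ennreal (1 / K) * (ennreal K * (\<Sum>i. ennreal (enn2real (diam_wrt d (U i)) powr s)))"
      by (rule mult_left_mono) simp
    also have "\<dots> = ennreal (1 / K * K) * (\<Sum>i. ennreal (enn2real (diam_wrt d (U i)) powr s))"
      using assms(3) by (subst ennreal_mult) (auto simp: mult.assoc)
    finally show "ennreal (1 / K) \<le> (\<Sum>i. ennreal (enn2real (diam_wrt d (U i)) powr s))"
      using assms(3) by simp
  qed
  also have "\<dots> \<le> hausdorff_measure d s E"
    unfolding hausdorff_measure_def by (rule SUP_upper) simp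
  finally show ?thesis using assms(3) by auto
qed

text \<open>The bound by 1 excludes an infinite diameter, which \<open>enn2real\<close> would send
  to 0.\<close>

lemma dist_le_enn2real_diam:
  assumes "x \<in> U" "y \<in> U" "diam_wrt d U \<le> 1"
  shows "d x y \<le> enn2real (diam_wrt d U)"
proof -
  have "ennreal (d x y) \<le> diam_wrt d U"
    unfolding diam_wrt_def using assms by (intro SUP_upper2[OF assms(1)] SUP_upper)
  then have "enn2real (ennreal (d x y)) \<le> enn2real (diam_wrt d U)"
    using assms(3) by (intro enn2real_mono) (auto simp: less_top[symmetric] top_unique)
  then show ?thesis
    by (cases "0 \<le> d x y") (auto intro: order_trans[OF _ enn2real_nonneg])
qed

text \<open>\<open>bound\<close> says s (2 S_n + D n) <= S_n + B, the mass estimate at the critical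
  scale where letters at index \<open>n\<close> differ in degree \<open>D n\<close>. The mass comes
  from a product of uniform measures on polynomials of degree \<open>D i\<close>.\<close>

lemma hausdorff_measure_prescribed_degrees:
  fixes D :: "nat \<Rightarrow> nat" and s B :: real
  assumes D1: "\<And>n. 1 \<le> D n" and s: "0 < s" "s \<le> 1"
    and bound: "\<And>n. s * D n \<le> (1 - 2 * s) * (\<Sum>i<n. D i) + B"
  shows "hausdorff_measure rho_infty s
    {x :: 'a :: {field, finite} fls. x \<in> infinite_cf \<and> (\<forall>i. degree (digit x i) = D i)} \<noteq> 0"
proof -
  let ?q = "real CARD('a)"
  let ?S = "\<lambda>n. \<Sum>i<n. D i"
  have q: "1 < ?q" by (rule card_field_gt_1)
  define F where "F i = {p :: 'a poly. degree p = D i}" for i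
  define M where "M i = uniform_count_measure (F i)" for i
  define P where "P = PiM UNIV M"
  have F: "finite (F i)" "?q ^ D i \<le> card (F i)" for i
    using card_degree_eq[OF D1[of i], where 'a = 'a] unfolding F_def of_nat_power[symmetric] of_nat_le_iff by auto
  have "F i \<noteq> {}" for i
    using F(2)[of i] q by (metis card.empty not_le of_nat_0 of_nat_0_less_iff zero_less_card_finite zero_less_power)
  then have M: "prob_space (M i)" for i
    unfolding M_def using F(1) by (intro prob_space_uniform_count_measure)
  have sets_M: "sets (M i) = Pow (F i)" and space_M: "space (M i) = F i" for i
    by (simp_all add: M_def sets_uniform_count_measure space_uniform_count_measure)
  have P: "prob_space P"
    unfolding P_def using M by (intro prob_space_PiM)
  have space_P: "\<omega> \<in> space P \<longleftrightarrow> (\<forall>i. degree (\<omega> i) = D i)" for \<omega>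
    by (auto simp: P_def space_PiM space_M F_def PiE_iff)

  \<comment> \<open>Finer than cylinders: the letter at \<open>n\<close> is fixed up to an error of
    degree \<open>e\<close>, which captures the intermediate scales. Even \<open>e = 0\<close>
    leaves a constant error.\<close>
  define cyl where "cyl \<omega>0 n e = {\<omega> \<in> space P. (\<forall>i<n. \<omega> i = \<omega>0 i) \<and> degree (\<omega> n - \<omega>0 n) \<le> e}"
    for \<omega>0 n and e :: nat
  have cyl: "cyl \<omega>0 n e \<in> sets P" "emeasure P (cyl \<omega>0 n e) \<le> ennreal (?q powr (- real (?S (Suc n)) + e + 1))"
    if \<omega>0: "\<omega>0 \<in> space P" for \<omega>0 n e
  proof -
    define A where "A i = (if i < n then {\<omega>0 i} else {p \<in> F i. degree (p - \<omega>0 i) \<le> e})" for i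
    have A: "A i \<subseteq> F i" for i
      using \<omega>0 by (auto simp: A_def space_P F_def)
    have "(\<forall>i\<le>n. \<omega> i \<in> A i) \<longleftrightarrow> (\<forall>i<n. \<omega> i = \<omega>0 i) \<and> degree (\<omega> n - \<omega>0 n) \<le> e"
      if "\<omega> \<in> space P" for \<omega>
      using that by (auto simp: le_less A_def space_P F_def)
    then have "cyl \<omega>0 n e = {\<omega> \<in> space P. \<forall>i\<le>n. \<omega> i \<in> A i}"
      by (auto simp: cyl_def)
    also have "\<dots> = prod_emb UNIV M {..n} (Pi\<^sub>E {..n} A)"
      by (auto simp: prod_emb_def P_def space_PiM PiE_iff)
    finally have eq: "cyl \<omega>0 n e = prod_emb UNIV M {..n} (Pi\<^sub>E {..n} A)" .
    show "cyl \<omega>0 n e \<in> sets P"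
      unfolding eq P_def by (rule sets_PiM_I) (auto simp: sets_M A)
    have "emeasure P (cyl \<omega>0 n e) = (\<Prod>i\<le>n. emeasure (M i) (A i))"
      unfolding eq P_def using M A by (intro emeasure_PiM_emb) (auto simp: sets_M)
    also have "\<dots> = (\<Prod>i\<le>n. ennreal (card (A i) / card (F i)))"
      using F(1) A by (simp add: M_def emeasure_uniform_count_measure)
    also have "\<dots> = ennreal (\<Prod>i\<le>n. card (A i) / card (F i))"
      by (intro prod_ennreal) simp
    \<comment> \<open>The earlier letters are fixed, and the last has at most q^(e+1) choices out of
      at least q^(D n).\<close>
    also have "(\<Prod>i\<le>n. card (A i) / card (F i)) \<le> (\<Prod>i\<le>n. (if i < n then 1 else ?q ^ Suc e) / ?q ^ D i)"
    proof (intro prod_mono conjI frac_le)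
      fix i
      show "real (card (A i)) \<le> (if i < n then 1 else ?q ^ Suc e)"
      proof (cases "i < n")
        case False
        then have "card (A i) \<le> card {p. degree (p - \<omega>0 i) \<le> e}"
          unfolding A_def by (intro card_mono) (auto simp: card_degree_diff_le)
        then have "real (card (A i)) \<le> real (CARD('a) ^ Suc e)"
          unfolding card_degree_diff_le by (rule of_nat_mono)
        then show ?thesis using False by simp
      qed (simp add: A_def)
    qed (use F q in auto)
    also have "\<dots> = ?q ^ Suc e / ?q ^ ?S (Suc n)"
    proof -
      have "(\<Prod>i\<le>n. if i < n then 1 else ?q ^ Suc e) = ?q ^ Suc e"
        by (simp add: lessThan_Suc_atMost[symmetric])
      then show ?thesis
        by (simp only: prod_dividef power_sum lessThan_Suc_atMost)
    qed
    also have "\<dots> = ?q powr (- real (?S (Suc n)) + e + 1)"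
    proof -
      have "?q ^ m / ?q ^ k = ?q powr (real m - real k)" for m k
        using q by (simp add: powr_diff powr_realpow)
      moreover have "real (Suc e) - real (?S (Suc n)) = - real (?S (Suc n)) + e + 1" by linarith
      ultimately show ?thesis by (simp only:)
    qed
    finally show "emeasure P (cyl \<omega>0 n e) \<le> ennreal (?q powr (- real (?S (Suc n)) + e + 1))"
      by (simp add: ennreal_leI)
  qed

  have degree_pos: "1 \<le> degree (\<omega> i)" if "\<omega> \<in> space P" for \<omega> i
    using that D1 by (simp add: space_P)
  \<comment> \<open>The exponent collects the slack \<open>B\<close> of \<open>bound\<close> and the
    1 from the count q^(e+1).\<close>
  define K where "K = ?q powr (B + 1)"
  show ?thesis
  proof (rule mass_distribution_principle[OF P, of cf_value _ K])
    show "cf_value ` space P \<subseteq> {x. x \<in> infinite_cf \<and> (\<forall>i. degree (digit x i) = D i)}"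
      using degree_pos by (auto simp: cf_value_in_infinite_cf digit_cf_value space_P)
    show "0 < K" using q by (simp add: K_def)
    fix U :: "'a fls set" assume U: "diam_wrt rho_infty U \<le> 1"
    let ?W = "{\<omega> \<in> space P. cf_value \<omega> \<in> U}"
    let ?b = "ennreal (K * enn2real (diam_wrt rho_infty U) powr s)"
    \<comment> \<open>Only two distinct preimages bound the diameter from below. With a single one
      \<open>U\<close> may have diameter 0, so its mass has to be shown to vanish.\<close>
    consider "?W = {}" | \<omega>0 where "?W = {\<omega>0}" | \<omega>0 \<omega>1 where "\<omega>0 \<in> ?W" "\<omega>1 \<in> ?W" "\<omega>0 \<noteq> \<omega>1"
      by blast
    then show "\<exists>C\<in>sets P. ?W \<subseteq> C \<and> emeasure P C \<le> ?b"
    proof cases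
      case 1
      then show ?thesis by (intro bexI[of _ "{}"]) auto
    next
      case 2
      then have \<omega>0: "\<omega>0 \<in> space P" by auto
      let ?C = "\<Inter>n. cyl \<omega>0 n 0"
      have C: "?C \<in> sets P" using cyl(1)[OF \<omega>0] by auto
      have "emeasure P ?C \<le> ennreal ((?q powr - 1) ^ n)" for n
      proof -
        have "emeasure P ?C \<le> emeasure P (cyl \<omega>0 n 0)"
          using cyl(1)[OF \<omega>0] by (intro emeasure_mono) auto
        also have "\<dots> \<le> ennreal (?q powr (- real (?S (Suc n)) + 0 + 1))"
          using cyl(2)[OF \<omega>0, of n 0] by simp
        also have "\<dots> \<le> ennreal (?q powr (- real n))"
        proof (intro ennreal_leI powr_mono)
          have "(\<Sum>i<Suc n. 1) \<le> ?S (Suc n)" by (rule sum_mono) (rule D1)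
          then have "Suc n \<le> ?S (Suc n)" by (simp del: sum.lessThan_Suc)
          then show "- real (?S (Suc n)) + 0 + 1 \<le> - real n" by linarith
        qed (use q in simp)
        also have "?q powr (- real n) = (?q powr - 1) ^ n"
          using q by (simp add: powr_minus_divide powr_realpow power_one_over)
        finally show ?thesis .
      qed
      moreover have "(\<lambda>n. ennreal ((?q powr - 1) ^ n)) \<longlonglongrightarrow> ennreal 0"
        using q powr_less_cancel_iff[of ?q "-1" 0] by (intro tendsto_ennrealI LIMSEQ_power_zero) auto
      ultimately have "emeasure P ?C \<le> ennreal 0"
        by (intro tendsto_lowerbound[of _ "ennreal 0"] always_eventually) auto
      moreover have "?W \<subseteq> ?C" using 2 \<omega>0 by (auto simp: cyl_def)
      ultimately show ?thesis using C by (intro bexI[of _ ?C]) auto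
    next
      case 3
      then have \<omega>0: "\<omega>0 \<in> space P" "cf_value \<omega>0 \<in> U" by auto
      \<comment> \<open>The first index at which some preimage departs from
        \<open>\<omega>0\<close>. Among the departing preimages one with maximal degree of
        difference is then chosen: a single \<open>cyl\<close> contains all preimages, and this pair
        realises its scale.\<close>
      define n where "n = (LEAST n. \<exists>\<omega>\<in>?W. \<omega> n \<noteq> \<omega>0 n)"
      have "\<exists>n. \<omega>1 n \<noteq> \<omega>0 n" using 3(3) unfolding fun_eq_iff by metis
      then have "\<exists>n. \<exists>\<omega>\<in>?W. \<omega> n \<noteq> \<omega>0 n" using 3(2) by blast
      then have n: "\<exists>\<omega>\<in>?W. \<omega> n \<noteq> \<omega>0 n" unfolding n_def by (rule LeastI_ex)
      have agree: "\<omega> i = \<omega>0 i" if "\<omega> \<in> ?W" "i < n" for \<omega> i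
        using not_less_Least[of i "\<lambda>n. \<exists>\<omega>\<in>?W. \<omega> n \<noteq> \<omega>0 n"] that unfolding n_def by blast
      let ?deg = "\<lambda>\<omega>. degree (\<omega> n - \<omega>0 n)"
      let ?V = "{\<omega>\<in>?W. \<omega> n \<noteq> \<omega>0 n}"
      have deg: "?deg \<omega> \<le> D n" if "\<omega> \<in> space P" for \<omega>
        using degree_diff_le[of "\<omega> n" "D n" "\<omega>0 n"] that \<omega>0(1) by (simp add: space_P)
      have "\<exists>\<omega>. \<omega> \<in> ?V \<and> (\<forall>\<omega>'. \<omega>' \<in> ?V \<longrightarrow> ?deg \<omega>' \<le> ?deg \<omega>)"
      proof -
        obtain \<omega> where "\<omega> \<in> ?V" using n by auto
        then show ?thesis
          by (rule ex_has_greatest_nat[of _ _ ?deg "Suc (D n)"]) (auto intro: le_imp_less_Suc deg)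
      qed
      then obtain \<omega> where \<omega>: "\<omega> \<in> ?V" "\<And>\<omega>'. \<omega>' \<in> ?V \<Longrightarrow> ?deg \<omega>' \<le> ?deg \<omega>" by blast
      let ?e = "?deg \<omega>"
      have "?deg \<omega>' \<le> ?e" if "\<omega>' \<in> ?W" for \<omega>'
        using \<omega>(2)[of \<omega>'] that by (cases "\<omega>' n = \<omega>0 n") auto
      then have sub: "?W \<subseteq> cyl \<omega>0 n ?e" using agree by (auto simp: cyl_def)
      have digits: "digit (cf_value \<omega>') i = \<omega>' i" if "\<omega>' \<in> space P" for \<omega>' i
        using degree_pos[OF that] by (intro digit_cf_value)
      have \<omega>P: "\<omega> \<in> space P" "cf_value \<omega> \<in> U" "\<omega> n \<noteq> \<omega>0 n" using \<omega>(1) by auto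
      have S: "digit_deg_sum (cf_value \<omega>) (Suc n) = ?S (Suc n)"
        unfolding digit_deg_sum_def digits[OF \<omega>P(1)] using \<omega>P(1) by (simp add: space_P)
      have "rho_infty (cf_value \<omega>) (cf_value \<omega>0) = ?q powr
          (- 2 * real (digit_deg_sum (cf_value \<omega>) (Suc n)) + real (degree (digit (cf_value \<omega>) n - digit (cf_value \<omega>0) n)))"
      proof (rule rho_infty_first_difference)
        show "cf_value \<omega> \<in> infinite_cf" "cf_value \<omega>0 \<in> infinite_cf"
          using degree_pos \<omega>0 \<omega>P by (auto intro: cf_value_in_infinite_cf)
        show "degree (digit (cf_value \<omega>) n) = degree (digit (cf_value \<omega>0) n)"
          using \<omega>0 \<omega>P by (simp add: digits space_P)
        show "digit (cf_value \<omega>) i = digit (cf_value \<omega>0) i" if "i < n" for i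
          using \<omega>0 \<omega>P agree[of \<omega> i] that \<omega>(1) by (simp add: digits)
      qed (use \<omega>0 \<omega>P in \<open>simp add: digits\<close>)
      then have "?q powr (- 2 * real (?S (Suc n)) + ?e) = rho_infty (cf_value \<omega>) (cf_value \<omega>0)"
        unfolding S digits[OF \<omega>P(1)] digits[OF \<omega>0(1)] by simp
      also have "\<dots> \<le> enn2real (diam_wrt rho_infty U)"
        using \<omega>0 \<omega>P U by (intro dist_le_enn2real_diam) auto
      finally have diam: "?q powr (- 2 * real (?S (Suc n)) + ?e) \<le> enn2real (diam_wrt rho_infty U)" .
      \<comment> \<open>As s <= 1, every \<open>e\<close> reduces to the extreme case e = D n, which
        is \<open>bound\<close>.\<close>
      have "(1 - s) * ?e \<le> (1 - s) * D n"
        using deg[OF \<omega>P(1)] s by (intro mult_left_mono) auto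
      then have "- real (?S (Suc n)) + ?e + 1 \<le> (B + 1) + (- 2 * real (?S (Suc n)) + ?e) * s"
        using bound[of n] by (simp add: algebra_simps)
      then have "?q powr (- real (?S (Suc n)) + ?e + 1) \<le> ?q powr ((B + 1) + (- 2 * real (?S (Suc n)) + ?e) * s)"
        using q by (intro powr_mono) auto
      also have "\<dots> = K * (?q powr (- 2 * real (?S (Suc n)) + ?e)) powr s"
        unfolding powr_powr K_def by (rule powr_add)
      also have "\<dots> \<le> K * enn2real (diam_wrt rho_infty U) powr s"
        using diam s by (intro mult_left_mono powr_mono2) (auto simp: K_def)
      finally have "?q powr (- real (?S (Suc n)) + ?e + 1) \<le> K * enn2real (diam_wrt rho_infty U) powr s" .
      then have "emeasure P (cyl \<omega>0 n ?e) \<le> ?b"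
        using cyl(2)[OF \<omega>0(1), of n ?e] by (meson ennreal_leI order_trans)
      then show ?thesis using sub cyl(1)[OF \<omega>0(1)] by blast
    qed
  qed
qed

subsection \<open>The sets $\mathcal G_k(\Phi)$\<close>

text \<open>As k >= 1, every window starts with index n + 1, so all partial quotients are
  defined.\<close>

lemma G_set_subset_infinite_cf:
  assumes "1 \<le> k"
  shows "G_set k \<Phi> \<subseteq> infinite_cf"
proof
  fix x assume "x \<in> G_set k \<Phi>"
  then have "x \<in> unit_ideal" and *: "\<And>n. \<forall>i\<in>{1..k}. partial_quotient_defined x (n + i)"
    by (auto simp: G_set_def)
  moreover have "partial_quotient_defined x (n + 1)" for n
    using *[of n] assms by (metis atLeastAtMost_iff order_refl)
  ultimately show "x \<in> infinite_cf"
    by (simp add: infinite_cf_def partial_quotient_defined_def)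
qed

text \<open>The window sum is the increment S_(n+k) - S_n, which turns membership into a growth
  condition.\<close>

lemma G_set_window:
  assumes "x \<in> G_set k \<Phi>"
  shows "\<Phi> n + digit_deg_sum x n \<le> digit_deg_sum x (n + k)"
proof -
  have "\<Phi> n \<le> (\<Sum>i=1..k. real (degree (partial_quotient x (n + i))))"
    using assms by (simp add: G_set_def)
  also have "\<dots> = (\<Sum>j<k. real (degree (digit x (n + j))))"
    by (rule sum.reindex_bij_witness[of _ Suc "\<lambda>i. i - 1"]) auto
  also have "\<dots> + digit_deg_sum x n = digit_deg_sum x (n + k)"
    by (induction k) (simp_all add: digit_deg_sum_Suc)
  finally show ?thesis by simp
qed

text \<open>From some N on, every k steps add at least a fixed amount to S. Since N depends on
  \<Phi> only, the growth is uniform over the set, as the covering argument requires.\<close>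

lemma G_set_growth:
  assumes "1 \<le> k" and "filterlim \<Phi> at_top sequentially"
  shows "\<exists>m0. \<forall>x\<in>G_set k \<Phi>. \<forall>m\<ge>m0. M * m \<le> digit_deg_sum x m"
proof -
  \<comment> \<open>A gain of \<open>L\<close> every k steps has rate 2 M; the spare factor 2
    absorbs the delay N + k once m >= 2 (N + k).\<close>
  define L where "L = 2 * k * M"
  obtain N where N: "\<And>n. N \<le> n \<Longrightarrow> real L \<le> \<Phi> n"
    using assms(2) by (auto simp: filterlim_at_top eventually_sequentially)
  have step: "L * (m - N - k) \<le> k * digit_deg_sum x m" if x: "x \<in> G_set k \<Phi>" for x m
  proof (induction m rule: less_induct)
    case (less m)
    show ?case
    proof (cases "N + k \<le> m")
      case True
      then obtain n where n: "m = n + k" "N \<le> n" by (metis add.commute add_le_imp_le_right le_add_diff_inverse2 add_leD2)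
      have "real L + digit_deg_sum x n \<le> digit_deg_sum x m"
        using G_set_window[OF x, of n] N[OF n(2)] n(1) by simp
      then have "L + digit_deg_sum x n \<le> digit_deg_sum x m" by linarith
      then have "k * L + k * digit_deg_sum x n \<le> k * digit_deg_sum x m"
        by (metis add_mult_distrib2 mult_le_mono2)
      moreover have "L * (n - N - k) \<le> k * digit_deg_sum x n"
        using assms(1) n(1) by (intro less) simp
      moreover have "L * (m - N - k) \<le> L * (n - N - k) + k * L"
      proof -
        have "m - N - k \<le> (n - N - k) + k" using n by simp
        then have "L * (m - N - k) \<le> L * ((n - N - k) + k)" by (rule mult_le_mono2)
        then show ?thesis by (simp add: algebra_simps)
      qed
      ultimately show ?thesis by linarith
    qed simp
  qed
  have "M * m \<le> digit_deg_sum x m" if "x \<in> G_set k \<Phi>" "2 * (N + k) \<le> m" for x m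
  proof -
    have "m \<le> 2 * (m - N - k)" using that(2) by simp
    then have "k * (M * m) \<le> k * (M * (2 * (m - N - k)))"
      by (intro mult_le_mono2)
    also have "\<dots> = L * (m - N - k)" by (simp add: L_def)
    also have "\<dots> \<le> k * digit_deg_sum x m" by (rule step[OF that(1)])
    finally show ?thesis using assms(1) by simp
  qed
  then show ?thesis by blast
qed

text \<open>If every late step multiplied S by less than c, then S_(n+k) would be O(c^n), against
  S_(n+k) >= \<Phi>(n) >= b^n for infinitely many n.\<close>

lemma G_set_jump:
  fixes b c :: real
  assumes "1 \<le> c" "c < b" and freq: "\<exists>\<^sub>F n in sequentially. b ^ n \<le> \<Phi> n" and x: "x \<in> G_set k \<Phi>"
  shows "\<exists>m\<ge>m0. c * digit_deg_sum x m \<le> digit_deg_sum x (Suc m)"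
proof (rule ccontr)
  let ?S = "\<lambda>m. real (digit_deg_sum x m)"
  assume "\<not> ?thesis"
  then have *: "?S (Suc m) \<le> c * ?S m" if "m0 \<le> m" for m
    using that linear by blast
  have growth: "?S (m0 + j) \<le> c ^ j * ?S m0" for j
  proof (induction j)
    case (Suc j)
    have "?S (m0 + Suc j) \<le> c * ?S (m0 + j)" using *[of "m0 + j"] by simp
    also have "\<dots> \<le> c * (c ^ j * ?S m0)" using Suc assms(1) by (intro mult_left_mono) auto
    finally show ?case by (simp add: mult.assoc)
  qed simp
  have upper: "b ^ n \<le> c ^ (n + k) * ?S m0" if "m0 \<le> n" "b ^ n \<le> \<Phi> n" for n
  proof -
    have "b ^ n \<le> ?S (n + k)" using G_set_window[OF x, of n] that(2) by simp
    also have "\<dots> \<le> c ^ (n + k - m0) * ?S m0" using growth[of "n + k - m0"] that(1) by simp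
    also have "\<dots> \<le> c ^ (n + k) * ?S m0"
      using assms(1) by (intro mult_right_mono power_increasing) auto
    finally show ?thesis .
  qed
  have bc: "1 < b / c" using assms(1,2) by simp
  then obtain N where N: "c ^ k * ?S m0 < (b / c) ^ N" using real_arch_pow by blast
  have "\<forall>\<^sub>F n in sequentially. \<not> b ^ n \<le> \<Phi> n"
    using eventually_ge_at_top[of N] eventually_ge_at_top[of m0]
  proof eventually_elim
    case (elim n)
    have "c ^ k * ?S m0 < (b / c) ^ n"
      using N power_increasing[of N n "b / c"] elim(1) bc by linarith
    then have "c ^ n * (c ^ k * ?S m0) < c ^ n * (b / c) ^ n"
      using assms(1) by (intro mult_strict_left_mono) auto
    then have "c ^ (n + k) * ?S m0 < b ^ n"
      using assms(1) by (simp add: power_divide power_add mult.assoc)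
    then show ?case using upper[OF elim(2)] by auto
  qed
  then show False using freq by (simp add: frequently_def)
qed

text \<open>With deg A_(n+1) of order C b^n, the first term of each window alone reaches \<Phi>(n).
  Then D n is about (b - 1) S_n, and the exponent S_n / (2 S_n + D n) tends to 1/(b + 1) >
  s.\<close>

lemma hausdorff_measure_G_set_pos:
  fixes b s :: real
  assumes "1 \<le> k" "1 < b" "0 < s" "s < 1 / (b + 1)"
    and ev: "\<forall>\<^sub>F n in sequentially. \<Phi> n \<le> b ^ n"
  shows "hausdorff_measure rho_infty s (G_set k \<Phi> :: 'a :: {field, finite} fls set) \<noteq> 0"
proof -
  obtain N where N: "\<And>n. N \<le> n \<Longrightarrow> \<Phi> n \<le> b ^ n"
    using ev by (auto simp: eventually_sequentially)
  \<comment> \<open>\<open>C\<close> takes care of the finitely many n before the power bound sets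
    in and keeps all degrees at least 1.\<close>
  define C where "C = Max (insert 1 (\<Phi> ` {..N}))"
  have C1: "1 \<le> C" unfolding C_def by (intro Max_ge) auto
  have \<Phi>: "\<Phi> n \<le> C * b ^ n" for n
  proof (cases "N \<le> n")
    case True
    have "1 * b ^ n \<le> C * b ^ n" using C1 assms(2) by (intro mult_right_mono) auto
    then show ?thesis using N[OF True] by simp
  next
    case False
    then have "\<Phi> n \<le> C" unfolding C_def by (intro Max_ge) auto
    also have "C * 1 \<le> C * b ^ n" using C1 assms(2) by (intro mult_left_mono) auto
    finally show ?thesis by simp
  qed
  define D where "D n = nat \<lceil>C * b ^ n\<rceil>" for n
  have Cb: "1 \<le> C * b ^ n" for n
    using mult_mono[of 1 C 1 "b ^ n"] C1 assms(2) by simp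
  have D: "C * b ^ n \<le> D n" "D n \<le> C * b ^ n + 1" for n
    using Cb[of n] unfolding D_def by linarith+
  have D1: "1 \<le> D n" for n
    using Cb[of n] D(1)[of n] by linarith
  have sb: "s * (b + 1) < 1" using assms(2,4) by (simp add: field_simps)
  have "s * 2 \<le> s * (b + 1)"
    using assms(2,3) by (intro mult_left_mono) auto
  also note sb
  finally have s: "2 * s < 1" by simp
  \<comment> \<open>The geometric sum gives C (b^n - 1) <= (b - 1) S_n, and s (b - 1) < 1 - 2 s. The
    constant is s C from the -1 plus s from rounding up.\<close>
  have "s * D n \<le> (1 - 2 * s) * (\<Sum>i<n. D i) + (s * C + s)" for n
  proof -
    have "s * (C * (b ^ n - 1)) = s * (b - 1) * (\<Sum>i<n. C * b ^ i)"
      using assms(2) by (simp add: sum_distrib_left[symmetric] power_diff_1_eq)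
    also have "\<dots> \<le> (1 - 2 * s) * (\<Sum>i<n. real (D i))"
      using sb s assms(2) C1 D(1) by (intro mult_mono sum_mono sum_nonneg) (auto simp: algebra_simps)
    finally have "s * (C * (b ^ n - 1)) \<le> (1 - 2 * s) * (\<Sum>i<n. D i)" by simp
    moreover have "s * D n \<le> s * (C * b ^ n + 1)"
      using D(2) assms(3) by (intro mult_left_mono) auto
    ultimately show ?thesis by (simp add: algebra_simps)
  qed
  from hausdorff_measure_prescribed_degrees[OF D1 assms(3) _ this, where 'a = 'a] s
  have "hausdorff_measure rho_infty s {x :: 'a fls. x \<in> infinite_cf \<and> (\<forall>i. degree (digit x i) = D i)} \<noteq> 0"
    by simp
  moreover have sub: "{x :: 'a fls. x \<in> infinite_cf \<and> (\<forall>i. degree (digit x i) = D i)} \<subseteq> G_set k \<Phi>"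
  proof safe
    fix x :: "'a fls" assume x: "x \<in> infinite_cf" "\<forall>i. degree (digit x i) = D i"
    have "\<Phi> n \<le> (\<Sum>i=1..k. real (degree (partial_quotient x (n + i))))" for n
    proof -
      have "\<Phi> n \<le> real (degree (partial_quotient x (n + 1)))"
        using \<Phi>[of n] D(1)[of n] x(2) by simp
      also have "\<dots> \<le> (\<Sum>i=1..k. real (degree (partial_quotient x (n + i))))"
        using assms(1) by (intro member_le_sum) auto
      finally show ?thesis .
    qed
    then show "x \<in> G_set k \<Phi>"
      using x(1) by (simp add: G_set_def infinite_cf_def partial_quotient_defined_def)
  qed
  ultimately show ?thesis
    using hausdorff_measure_mono[OF sub, of rho_infty s] by auto
qed

section \<open>Comparing \<Phi> with powers through the limsup\<close>

lemma frequently_power_le: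
  fixes b :: real
  assumes "0 < b" and pos: "\<And>n. \<Phi> n > 0"
    and "ereal (ln b) < limsup (\<lambda>n. ereal (ln (\<Phi> n) / real n))"
  shows "\<exists>\<^sub>F n in sequentially. b ^ n \<le> \<Phi> n"
proof (rule ccontr)
  assume "\<not> ?thesis"
  then have "\<forall>\<^sub>F n in sequentially. \<not> b ^ n \<le> \<Phi> n" by (simp add: frequently_def)
  \<comment> \<open>At n = 0 the quotient has the default value 0, so that index is
    excluded.\<close>
  then have "\<forall>\<^sub>F n in sequentially. ereal (ln (\<Phi> n) / real n) \<le> ereal (ln b)"
    using eventually_gt_at_top[of 0]
  proof eventually_elim
    case (elim n)
    then have "ln (\<Phi> n) \<le> ln (b ^ n)" using pos[of n] assms(1) by simp
    then show ?case using assms(1) elim(2) by (simp add: ln_realpow field_simps)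
  qed
  then have "limsup (\<lambda>n. ereal (ln (\<Phi> n) / real n)) \<le> ereal (ln b)"
    by (rule Limsup_bounded)
  then show False using assms(3) by simp
qed

lemma eventually_le_power:
  fixes b :: real
  assumes "0 < b" and pos: "\<And>n. \<Phi> n > 0"
    and "limsup (\<lambda>n. ereal (ln (\<Phi> n) / real n)) < ereal (ln b)"
  shows "\<forall>\<^sub>F n in sequentially. \<Phi> n \<le> b ^ n"
  using Limsup_lessD[OF assms(3)] eventually_gt_at_top[of 0]
proof eventually_elim
  case (elim n)
  then have "ln (\<Phi> n) \<le> ln (b ^ n)" using assms(1) by (simp add: ln_realpow field_simps)
  then show ?case using pos[of n] assms(1) by simp
qed

theorem theorem1p3:
  fixes k :: nat and \<Phi> :: "nat \<Rightarrow> real" and a :: ereal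
  assumes "k \<ge> 1"
    and "\<And>n. \<Phi> n > 0"
    and "filterlim \<Phi> at_top sequentially"
    and "1 \<le> a"
    and "ln_ext a = limsup (\<lambda>n. ereal (ln (\<Phi> n) / real n))"
  shows "hausdorff_dim rho_infty (G_set k \<Phi> :: 'a :: {field, finite} fls set) = 1 / (a + 1)"
proof (rule antisym)
  let ?G = "G_set k \<Phi> :: 'a fls set"
  show "hausdorff_dim rho_infty ?G \<le> 1 / (a + 1)"
  proof (rule dense_ge)
    fix t assume t: "1 / (a + 1) < t"
    show "hausdorff_dim rho_infty ?G \<le> t"
    proof (cases t)
      case (real s)
      \<comment> \<open>The inequality 1/(a + 1) < s solved for a, in a form that also covers a =
        \<infinity>.\<close>
      have "0 < s \<and> ereal (1 / s - 1) < a"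
      proof (cases a)
        case a: (real r)
        then have "1 \<le> r" "1 / (r + 1) < s" using t real assms(4) by (auto simp: one_ereal_def)
        moreover from this have "0 < s" by (smt (verit) divide_pos_pos)
        ultimately show ?thesis using a by (simp add: field_simps)
      qed (use t real assms(4) in auto)
      then have s: "0 < s" "ereal (1 / s - 1) < a" by auto
      \<comment> \<open>In general c lies between 1/s - 1 and a. If 1/s - 1 < 1, then c = 1 is
        taken, which includes a = 1; jumps by the factor 1 are automatic.\<close>
      obtain c :: real where c: "1 \<le> c" "1 / s - 1 < c" "c = 1 \<or> ereal c < a"
      proof (cases "1 / s - 1 < 1")
        case False
        obtain c where "ereal (1 / s - 1) < ereal c" "ereal c < a"
          using ereal_dense2[OF s(2)] by blast
        then show thesis using that False by auto
      qed (use that in auto)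
      have "hausdorff_measure rho_infty s ?G = 0"
      proof (rule hausdorff_measure_eq_0[OF G_set_subset_infinite_cf[OF assms(1)] c(1)])
        show "1 / (c + 1) < s" using c(1,2) s(1) by (simp add: field_simps)
        show "\<exists>m0. \<forall>x\<in>?G. \<forall>m\<ge>m0. M * m \<le> digit_deg_sum x m" for M
          by (rule G_set_growth[OF assms(1,3)])
        fix x :: "'a fls" and m0 assume x: "x \<in> ?G"
        show "\<exists>m\<ge>m0. c * digit_deg_sum x m \<le> digit_deg_sum x (Suc m)"
          using c(3)
        proof
          assume "ereal c < a"
          \<comment> \<open>The gap between \<open>c\<close> and \<open>b\<close> feeds the jump
            argument, the gap between \<open>b\<close> and \<open>a\<close> gives \<Phi>(n) >= b^n
            infinitely often.\<close>
          then obtain b :: real where b: "c < b" "ereal b < a"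
            using ereal_dense2 by fastforce
          have "ereal (ln b) < ln_ext a"
            using b c(1) by (cases a) (auto simp: ln_ext_def)
          then have "\<exists>\<^sub>F n in sequentially. b ^ n \<le> \<Phi> n"
            using b c(1) assms(2,5) by (intro frequently_power_le) auto
          then show ?thesis by (rule G_set_jump[OF c(1) b(1) _ x])
        qed (auto simp: digit_deg_sum_Suc)
      qed
      then show ?thesis
        unfolding hausdorff_dim_def real using s(1) by (intro INF_lower) auto
    qed (use t in auto)
  qed
  show "1 / (a + 1) \<le> hausdorff_dim rho_infty ?G"
    unfolding hausdorff_dim_def
  proof (rule INF_greatest)
    fix s assume "s \<in> {s. 0 < s \<and> hausdorff_measure rho_infty s ?G = 0}"
    then have s: "0 < s" "hausdorff_measure rho_infty s ?G = 0" by auto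
    show "1 / (a + 1) \<le> ereal s"
    proof (cases a)
      case (real r)
      have r: "1 \<le> r" using assms(4) real by simp
      show ?thesis
      proof (rule ccontr)
        assume "\<not> ?thesis"
        then have "s < 1 / (r + 1)" using real r by (auto simp: one_ereal_def)
        then have "r < 1 / s - 1" using s(1) r by (simp add: field_simps)
        \<comment> \<open>Room on both sides: b > r makes \<Phi>(n) <= b^n eventually, while s <
          1/(b + 1) still holds.\<close>
        then obtain b where b: "r < b" "b < 1 / s - 1" using dense by blast
        have "s < 1 / (b + 1)" using b(2) s(1) b(1) r by (simp add: field_simps)
        moreover have "limsup (\<lambda>n. ereal (ln (\<Phi> n) / real n)) < ereal (ln b)"
          using b(1) r real unfolding assms(5)[symmetric] by (simp add: ln_ext_def)
        then have "\<forall>\<^sub>F n in sequentially. \<Phi> n \<le> b ^ n"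
          using b(1) r assms(2) by (intro eventually_le_power) auto
        ultimately have "hausdorff_measure rho_infty s ?G \<noteq> 0"
          using assms(1) b(1) r s(1) by (intro hausdorff_measure_G_set_pos) auto
        then show False using s(2) by simp
      qed
    next
      \<comment> \<open>Here 1/(a + 1) is 0, and only positive exponents enter the infimum.\<close>
      case PInf
      then show ?thesis using s(1) by simp
    qed (use assms(4) in simp)
  qed
qed

end
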